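(* Fix an integer $q \ge 2$, an integer $w \ge 1$, and an even integer $d$ with $2 \le d \le 2w$. Let $t := \lceil \frac{2w-d+1}{2} \rceil = w - \frac{1}{2}d + 1$. Then, as $n \to \infty$ (with $q, d, w$ fixed), \[ A_q(n,d,w) = (1+o(1)) \frac{(q-1)^{t-1}\binom{n}{t}}{\binom{w}{t}}. \]
   Context: Let $\Sigma_q = \{0,1,\ldots,q-1\}$ and let $\Sigma_q^n$ be the set of $n$-dimensional vectors with entries in $\Sigma_q$. For $\mathbf{x} \in \Sigma_q^n$ with entries $x_1,\dots,x_n$, its support is $\mathrm{supp}(\mathbf{x}) = \{i : x_i \neq 0\}$ and its weight is $|\mathrm{supp}(\mathbf{x})|$. The Hamming distance between $\mathbf{x},\mathbf{y} \in \Sigma_q^n$ is $|\{i : x_i \neq y_i\}|$. A $q$-ary code of length $n$ is a subset $C \subseteq \Sigma_q^n$; it has constant weight $w$ if every element has weight exactly $w$, and minimum distance $d$ if any two distinct elements have Hamming distance at least $d$. $A_q(n,d,w)$ denotes the largest possible cardinality of a $q$-ary code of length $n$ with constant weight $w$ and minimum distance $d$. The notation $o(1)$ refers to a quantity tending to $0$ as $n \to \infty$ with $q,d,w$ fixed. *)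

theory Defs
  imports Complex_Main
begin

definition qvecs :: "nat \<Rightarrow> nat \<Rightarrow> (nat \<Rightarrow> nat) set" where
  "qvecs q n = {x. (\<forall>i<n. x i < q) \<and> (\<forall>i\<ge>n. x i = 0)}"

definition supp :: "nat \<Rightarrow> (nat \<Rightarrow> nat) \<Rightarrow> nat set" where
  "supp n x = {i. i < n \<and> x i \<noteq> 0}"

definition weight :: "nat \<Rightarrow> (nat \<Rightarrow> nat) \<Rightarrow> nat" where
  "weight n x = card (supp n x)"

definition hdist :: "nat \<Rightarrow> (nat \<Rightarrow> nat) \<Rightarrow> (nat \<Rightarrow> nat) \<Rightarrow> nat" where
  "hdist n x y = card {i. i < n \<and> x i \<noteq> y i}"

definition cw_code :: "nat \<Rightarrow> nat \<Rightarrow> nat \<Rightarrow> nat \<Rightarrow> (nat \<Rightarrow> nat) set \<Rightarrow> bool" where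
  "cw_code q n d w C \<longleftrightarrow> C \<subseteq> qvecs q n \<and> (\<forall>x\<in>C. weight n x = w) \<and>
     (\<forall>x\<in>C. \<forall>y\<in>C. x \<noteq> y \<longrightarrow> hdist n x y \<ge> d)"

definition A_q :: "nat \<Rightarrow> nat \<Rightarrow> nat \<Rightarrow> nat \<Rightarrow> nat" where
  "A_q q n d w = Max {card C | C. cw_code q n d w C}"

end

theory Submission
  imports Defs "HOL-Library.FuncSet" "HOL-Number_Theory.Cong"
begin

text \<open>
Write \<open>Q = q - 1\<close>. Codewords whose supports contain a fixed \<open>t\<close>-set \<open>T\<close> are pairwise distinct on \<open>T\<close>
minus a point, so there are at most \<open>Q ^ (t - 1)\<close> of them; double counting gives the upper bound.

The lower bound comes from a nearly perfect matching, found with the Roedl nibble. Requiring that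
the symbols on \<open>T\<close> satisfy one linear equation modulo \<open>Q\<close> leaves \<open>Q ^ (t - 1)\<close> patterns on \<open>T\<close>, any two
at distance at least 2. The hypergraph has these patterns as vertices and the words all of whose
\<open>t\<close>-sets satisfy their equation as edges. To make it regular, every coordinate gets one
of \<open>r\<close> types, and for each \<open>t\<close>-set \<open>P\<close> of types an attribute in \<open>{..<Q}\<close>, with every combination
occurring equally often. Only words whose coordinates have distinct types are used, and the
constant of the equation on \<open>T\<close> is determined by the attributes of its points at the type set of \<open>T\<close>.
The \<open>(t + 1)\<close>-sets of coordinates are added as further vertices; their degrees are negligible,
and they force the supports of matched words to meet in at most \<open>t\<close> points. First \<open>n\<close>, then
\<open>r\<close> tends to infinity.

The nibble is an induction on the guaranteed density \<open>\<rho>\<close>: a random set of edges of density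
\<open>\<theta> / D\<close> contributes about \<open>\<theta> |E| / D\<close> isolated edges, and what survives is a hypergraph with
ratio of edges to maximal degree about \<open>(1 - \<theta>) |E| / D\<close>, so \<open>\<rho>\<close> improves to about
\<open>\<rho> + \<theta> (1 - \<rho>)\<close>.
\<close>

section \<open>Random subsets of a finite set\<close>

text \<open>The expectation of \<open>f F\<close> for a random \<open>F \<subseteq> I\<close> that
  contains each element independently with probability \<open>p\<close>, written as a finite
  sum.\<close>

definition rexp :: "real \<Rightarrow> 'a set \<Rightarrow> ('a set \<Rightarrow> real) \<Rightarrow> real" where
  "rexp p I f = (\<Sum>F\<in>Pow I. p ^ card F * (1 - p) ^ card (I - F) * f F)"

lemma rexp_add: "rexp p I (\<lambda>F. f F + g F) = rexp p I f + rexp p I g"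
  by (simp add: rexp_def ring_distribs sum.distrib)

lemma rexp_cmult: "rexp p I (\<lambda>F. c * f F) = c * rexp p I f"
  by (simp add: rexp_def sum_distrib_left mult_ac)

lemma rexp_diff: "rexp p I (\<lambda>F. f F - g F) = rexp p I f - rexp p I g"
  by (simp add: rexp_def ring_distribs sum_subtractf)

lemma rexp_sum: "rexp p I (\<lambda>F. \<Sum>x\<in>A. f x F) = (\<Sum>x\<in>A. rexp p I (f x))"
  unfolding rexp_def sum_distrib_left by (rule sum.swap)

lemma rexp_mono:
  assumes "0 \<le> p" "p \<le> 1" "\<And>F. F \<subseteq> I \<Longrightarrow> f F \<le> g F"
  shows "rexp p I f \<le> rexp p I g"
  unfolding rexp_def using assms by (intro sum_mono mult_left_mono) auto

text \<open>Expand the product of \<open>p + (1 - p)\<close> over \<open>I\<close>: the weights form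
  a probability distribution.\<close>

lemma sum_Pow_binomial_weights:
  assumes "finite I"
  shows "(\<Sum>F\<in>Pow I. p ^ card F * (1 - p) ^ card (I - F)) = (1::real)"
  using prod_add[OF assms, of "\<lambda>_. p" "\<lambda>_. 1 - p"] by simp

text \<open>Only subsets of \<open>I - B\<close> contribute. The factor
  \<open>(1 - p) ^ card B\<close> splits off, and what is left is the total weight of the random
  subsets of \<open>I - B\<close>.\<close>

lemma rexp_avoid:
  assumes "finite I" "B \<subseteq> I"
  shows "rexp p I (\<lambda>F. of_bool (F \<inter> B = {})) = (1 - p) ^ card B"
proof -
  have fB: "finite B" using assms finite_subset by blast
  have "rexp p I (\<lambda>F. of_bool (F \<inter> B = {})) =
        (\<Sum>F\<in>Pow (I - B). p ^ card F * (1 - p) ^ card (I - F))"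
    unfolding rexp_def using assms
    by (intro sum.mono_neutral_cong_right) auto
  also have "\<dots> = (\<Sum>F\<in>Pow (I - B). (1 - p) ^ card B * (p ^ card F * (1 - p) ^ card ((I - B) - F)))"
  proof (intro sum.cong refl)
    fix F assume F: "F \<in> Pow (I - B)"
    have "I - F = B \<union> ((I - B) - F)" using F assms by auto
    then have "card (I - F) = card B + card ((I - B) - F)"
      using card_Un_disjoint[OF fB, of "(I - B) - F"] assms by auto
    then show "p ^ card F * (1 - p) ^ card (I - F) =
        (1 - p) ^ card B * (p ^ card F * (1 - p) ^ card ((I - B) - F))"
      by (simp add: power_add)
  qed
  also have "\<dots> = (1 - p) ^ card B"
    using sum_Pow_binomial_weights[of "I - B" p] assms
    by (simp flip: sum_distrib_left)
  finally show ?thesis .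
qed

lemma rexp_const:
  assumes "finite I"
  shows "rexp p I (\<lambda>F. c) = c"
  using rexp_avoid[OF assms, of "{}" p] rexp_cmult[of p I c "\<lambda>_. 1"] by simp

text \<open>The event is the difference of two avoidance events, for \<open>B - {x}\<close> and for
  \<open>B\<close>.\<close>

lemma rexp_single:
  assumes "finite I" "B \<subseteq> I" "x \<in> B"
  shows "rexp p I (\<lambda>F. of_bool (F \<inter> B = {x})) = p * (1 - p) ^ (card B - 1)"
proof -
  have fB: "finite B" using assms finite_subset by blast
  have "rexp p I (\<lambda>F. of_bool (F \<inter> B = {x})) =
     rexp p I (\<lambda>F. of_bool (F \<inter> (B - {x}) = {}) - of_bool (F \<inter> B = {}))"
    using assms(3) by (intro arg_cong[where f = "rexp p I"] ext) auto
  also have "\<dots> = (1 - p) ^ (card B - 1) - (1 - p) ^ card B"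
    using assms fB by (simp add: rexp_diff rexp_avoid subset_iff)
  also have "card B = Suc (card B - 1)"
    using assms fB by (metis Suc_pred' card_gt_0_iff empty_iff)
  then have "(1 - p) ^ card B = (1 - p) * (1 - p) ^ (card B - 1)"
    by (metis power_Suc)
  then have "(1 - p) ^ (card B - 1) - (1 - p) ^ card B = p * (1 - p) ^ (card B - 1)"
    by (simp add: algebra_simps)
  finally show ?thesis .
qed

text \<open>The first moment method: some outcome is at least the mean.\<close>

lemma rexp_exists_ge:
  assumes "finite I" "0 \<le> p" "p \<le> 1" "c \<le> rexp p I f"
  shows "\<exists>F\<subseteq>I. c \<le> f F"
proof (rule ccontr)
  assume no: "\<not> ?thesis"
  have less: "f F < c" if "F \<subseteq> I" for F using no that by (meson not_less)
  define m where "m = Max (f ` Pow I)"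
  have m: "f F \<le> m" if "F \<subseteq> I" for F
    unfolding m_def using that assms by (intro Max_ge) auto
  have "m \<in> f ` Pow I" unfolding m_def using assms by (intro Max_in) auto
  then have "m < c" using less by auto
  moreover have "rexp p I f \<le> rexp p I (\<lambda>_. m)"
    using assms m by (intro rexp_mono) auto
  ultimately show False using assms rexp_const[OF assms(1), of p m] by linarith
qed

text \<open>A weak Bonferroni inequality. A new set shares at most \<open>c\<close> elements with
  each earlier one, and the total loss is bounded crudely by the square of
  \<open>card W\<close>.\<close>

lemma card_UN_ge:
  fixes c :: real
  assumes "finite W" "\<And>u. u \<in> W \<Longrightarrow> finite (K u)" "\<And>u. u \<in> W \<Longrightarrow> card (K u) = D"
    and "\<And>u v. u \<in> W \<Longrightarrow> v \<in> W \<Longrightarrow> u \<noteq> v \<Longrightarrow> real (card (K u \<inter> K v)) \<le> c" "0 \<le> c"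
  shows "real (card W) * D - real (card W) ^ 2 * c \<le> card (\<Union>u\<in>W. K u)"
  using assms
proof (induction W rule: finite_induct)
  case empty
  then show ?case by simp
next
  case (insert w W)
  have "K w \<inter> (\<Union>u\<in>W. K u) = (\<Union>u\<in>W. K w \<inter> K u)" by auto
  then have "real (card (K w \<inter> (\<Union>u\<in>W. K u))) \<le> (\<Sum>u\<in>W. real (card (K w \<inter> K u)))"
    using of_nat_mono[OF card_UN_le[OF insert.hyps(1), of "\<lambda>u. K w \<inter> K u"], where 'a = real]
    by simp
  also have "\<dots> \<le> (\<Sum>u\<in>W. c)"
    using insert by (intro sum_mono) auto
  finally have inter: "real (card (K w \<inter> (\<Union>u\<in>W. K u))) \<le> card W * c" by simp
  have "real (card (K w)) + card (\<Union>u\<in>W. K u) = card (\<Union>u\<in>insert w W. K u) + card (K w \<inter> (\<Union>u\<in>W. K u))"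
  proof -
    have "finite (K w)" "finite (\<Union>u\<in>W. K u)" using insert by auto
    from card_Un_Int[OF this] show ?thesis by (simp flip: of_nat_add)
  qed
  moreover have "real (card W) * D - real (card W) ^ 2 * c \<le> card (\<Union>u\<in>W. K u)"
    by (rule insert.IH) (use insert.prems in auto)
  moreover have "card (K w) = D" using insert.prems by simp
  ultimately have "real (card W + 1) * D - (real (card W) ^ 2 + card W) * c \<le> card (\<Union>u\<in>insert w W. K u)"
    using inter by (simp add: distrib_right)
  moreover have "(real (card W) ^ 2 + card W) * c \<le> real (card W + 1) ^ 2 * c"
    using insert.prems by (intro mult_right_mono) (auto simp: power2_eq_square algebra_simps)
  ultimately show ?case using insert.hyps by simp
qed

section \<open>Nearly perfect matchings\<close>

definition hmatching :: "('e \<Rightarrow> 'v set) \<Rightarrow> 'e set \<Rightarrow> bool" where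
  "hmatching V M \<longleftrightarrow> (\<forall>e\<in>M. \<forall>f\<in>M. e \<noteq> f \<longrightarrow> V e \<inter> V f = {})"

text \<open>Edges are abstract indices and \<open>V\<close> gives their vertex sets, so passing to a
  subfamily of edges leaves \<open>V\<close> unchanged. The codegree bound \<open>c\<close> is real
  because it is used as a small multiple of \<open>D\<close>.\<close>

definition bounded_hypergraph :: "nat \<Rightarrow> nat \<Rightarrow> real \<Rightarrow> 'e set \<Rightarrow> ('e \<Rightarrow> 'v set) \<Rightarrow> bool" where
  "bounded_hypergraph k D c E V \<longleftrightarrow> finite E \<and> (\<forall>e\<in>E. finite (V e) \<and> card (V e) = k) \<and>
     (\<forall>v. card {e\<in>E. v \<in> V e} \<le> D) \<and>
     (\<forall>u v. u \<noteq> v \<longrightarrow> real (card {e\<in>E. u \<in> V e \<and> v \<in> V e}) \<le> c)"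

section \<open>One round of the nibble\<close>

locale nibble =
  fixes k D :: nat and c :: real and E :: "'e set" and V :: "'e \<Rightarrow> 'v set" and \<theta> :: real
  assumes hg: "bounded_hypergraph k D c E V"
    and k: "k \<ge> 1" and D: "D \<ge> 1" and c: "c \<ge> 0" and \<theta>: "0 < \<theta>" "\<theta> < 1"
begin

definition "p = \<theta> / D"
definition "q = (1 - p) ^ D"
definition "star v = {e\<in>E. v \<in> V e}"

text \<open>The dummy elements pad the star of every vertex to exactly \<open>D\<close> elements, so that all
  vertices survive with the same probability \<open>q\<close>.\<close>

definition kill :: "'v \<Rightarrow> ('e + 'v \<times> nat) set" where
  "kill v = Inl ` star v \<union> Inr ` ({v} \<times> {..<D - card (star v)})"

definition "kills W = (\<Union>v\<in>W. kill v)"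
definition "verts = (\<Union>e\<in>E. V e)"
definition "ground = Inl ` E \<union> Inr ` (verts \<times> {..<D})"
text \<open>Survival of \<open>v\<close> itself is excluded: being common to all edges at
  \<open>v\<close>, it would destroy concentration. The mean is about
  \<open>card (star v) * q ^ (k - 1)\<close>.\<close>

definition "deg_alive F v = (\<Sum>e\<in>star v. of_bool (F \<inter> kills (V e - {v}) = {}) :: real)"
definition "bad \<gamma> F v \<longleftrightarrow> deg_alive F v > D * (q ^ (k - 1) + \<gamma>)"
text \<open>Edges at bad vertices are thrown away, so that the degree bound for the next round holds
  at every vertex and not merely at most of them.\<close>

definition "rest \<gamma> F = {e\<in>E. F \<inter> kills (V e) = {} \<and> (\<forall>v\<in>V e. \<not> bad \<gamma> F v)}"
definition "chosen F = {e\<in>E. F \<inter> kills (V e) = {Inl e}}"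

lemma finite_E: "finite E"
  using hg by (simp add: bounded_hypergraph_def)

lemma finite_V: "e \<in> E \<Longrightarrow> finite (V e)"
  using hg by (simp add: bounded_hypergraph_def)

lemma card_V: "e \<in> E \<Longrightarrow> card (V e) = k"
  using hg by (simp add: bounded_hypergraph_def)

lemma finite_star [simp]: "finite (star v)"
  using finite_E by (simp add: star_def)

lemma card_star: "card (star v) \<le> D"
  using hg by (simp add: bounded_hypergraph_def star_def)

lemma card_star_Int: "u \<noteq> v \<Longrightarrow> real (card (star u \<inter> star v)) \<le> c"
proof -
  assume "u \<noteq> v"
  moreover have "star u \<inter> star v = {e\<in>E. u \<in> V e \<and> v \<in> V e}" by (auto simp: star_def)
  ultimately show ?thesis using hg by (simp add: bounded_hypergraph_def)
qed

lemma finite_kill: "finite (kill v)"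
  by (simp add: kill_def)

lemma card_kill: "card (kill v) = D"
proof -
  have "card (kill v) = card (Inl ` star v :: ('e + 'v \<times> nat) set) +
      card (Inr ` ({v} \<times> {..<D - card (star v)}) :: ('e + 'v \<times> nat) set)"
    unfolding kill_def by (intro card_Un_disjoint) auto
  then show ?thesis using card_star[of v] by (simp add: card_image card_cartesian_product)
qed

lemma card_kill_Int: "u \<noteq> v \<Longrightarrow> real (card (kill u \<inter> kill v)) \<le> c"
proof -
  assume uv: "u \<noteq> v"
  then have "kill u \<inter> kill v = Inl ` (star u \<inter> star v)" by (auto simp: kill_def)
  then show ?thesis using card_star_Int[OF uv] by (simp add: card_image)
qed

lemma finite_verts: "finite verts"
  by (auto simp: verts_def finite_E finite_V)

lemma finite_ground: "finite ground"
  by (auto simp: ground_def finite_E finite_verts)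

lemma kills_subset: "W \<subseteq> verts \<Longrightarrow> kills W \<subseteq> ground"
  by (auto simp: kills_def kill_def ground_def star_def)

lemma kills_Un: "kills (W \<union> W') = kills W \<union> kills W'"
  by (auto simp: kills_def)

lemma p_bounds: "0 \<le> p" "p \<le> 1"
  using \<theta> D by (auto simp: p_def field_simps)

lemma q_bounds: "1 - \<theta> \<le> q" "q \<le> 1" "0 \<le> q"
proof -
  have "1 + real D * (- p) \<le> (1 + (- p)) ^ D"
    using p_bounds by (intro Bernoulli_inequality) auto
  then show "1 - \<theta> \<le> q" using D by (simp add: p_def q_def)
  show "q \<le> 1" "0 \<le> q" unfolding q_def using p_bounds by (auto intro: power_le_one)
qed

text \<open>The probability is \<open>1 - p\<close> to the power \<open>card (kills W)\<close>. This
  cardinality is at most \<open>card W * D\<close>, and small codegrees keep the deficit below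
  \<open>(card W)\<^sup>2 * c\<close>; by Bernoulli each missing element costs at most
  \<open>p\<close>.\<close>

lemma survival:
  assumes W: "W \<subseteq> verts"
  shows "q ^ card W \<le> rexp p ground (\<lambda>F. of_bool (F \<inter> kills W = {}))"
    and "rexp p ground (\<lambda>F. of_bool (F \<inter> kills W = {})) \<le> q ^ card W + real (card W) ^ 2 * c * p"
proof -
  have fW: "finite W" using W finite_verts finite_subset by blast
  let ?b = "card (kills W)"
  have eq: "rexp p ground (\<lambda>F. of_bool (F \<inter> kills W = {})) = (1 - p) ^ ?b"
    using finite_ground kills_subset[OF W] by (rule rexp_avoid)
  have "?b \<le> (\<Sum>u\<in>W. card (kill u))"
    unfolding kills_def by (rule card_UN_le[OF fW])
  then have b: "?b \<le> card W * D" by (simp add: card_kill)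
  have qW: "q ^ card W = (1 - p) ^ (card W * D)"
    by (simp add: q_def mult.commute flip: power_mult)
  show "q ^ card W \<le> rexp p ground (\<lambda>F. of_bool (F \<inter> kills W = {}))"
    unfolding eq qW using b p_bounds by (intro power_decreasing) auto
  define x where "x = card W * D - ?b"
  have "real (card W) * D - real (card W) ^ 2 * c \<le> ?b"
    unfolding kills_def using fW finite_kill card_kill card_kill_Int c by (intro card_UN_ge) auto
  moreover have "real x = real (card W) * D - ?b"
    using b by (simp add: x_def of_nat_diff)
  ultimately have x: "real x \<le> real (card W) ^ 2 * c" by linarith
  have "1 + real x * (- p) \<le> (1 + (- p)) ^ x"
    using p_bounds by (intro Bernoulli_inequality) auto
  then have "(1 - p) ^ ?b * (1 - x * p) \<le> (1 - p) ^ ?b * (1 - p) ^ x"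
    using p_bounds by (intro mult_left_mono) auto
  also have "\<dots> = q ^ card W"
    unfolding qW using b by (simp add: x_def flip: power_add)
  finally have "(1 - p) ^ ?b \<le> q ^ card W + (1 - p) ^ ?b * (x * p)"
    by (simp add: algebra_simps)
  also have "(1 - p) ^ ?b * (x * p) \<le> 1 * (x * p)"
    using p_bounds by (intro mult_right_mono power_le_one) auto
  also have "1 * (x * p) \<le> real (card W) ^ 2 * c * p"
    using x p_bounds by (simp add: mult_right_mono)
  finally show "rexp p ground (\<lambda>F. of_bool (F \<inter> kills W = {})) \<le> q ^ card W + real (card W) ^ 2 * c * p"
    unfolding eq by simp
qed

text \<open>Two edges at \<open>v\<close> that meet only in \<open>v\<close> survive almost
  independently, by \<open>survival\<close> for the union of their other vertices. The remaining
  pairs are bounded by 1 each and are few because codegrees are small.\<close>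

lemma deg_alive_second_moment:
  assumes v: "v \<in> verts"
  defines "\<mu> \<equiv> card (star v) * q ^ (k - 1)"
  shows "rexp p ground (\<lambda>F. (deg_alive F v - \<mu>) ^ 2) \<le> real D ^ 2 * (4 * real k ^ 2 * c * p) + D * (k * c)"
proof -
  define d where "d = real (card (star v))"
  define A where "A e f = rexp p ground (\<lambda>F. of_bool (F \<inter> kills ((V e \<union> V f) - {v}) = {}))" for e f
  have d: "0 \<le> d" "d \<le> D" using card_star[of v] by (auto simp: d_def)
  have starE: "e \<in> E" "v \<in> V e" if "e \<in> star v" for e using that by (auto simp: star_def)
  have sub: "V e \<subseteq> verts" if "e \<in> star v" for e using that by (auto simp: star_def verts_def)
  have first: "\<mu> \<le> rexp p ground (\<lambda>F. deg_alive F v)"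
  proof -
    have "(\<Sum>e\<in>star v. q ^ (k - 1)) \<le>
      (\<Sum>e\<in>star v. rexp p ground (\<lambda>F. of_bool (F \<inter> kills (V e - {v}) = {})))"
    proof (rule sum_mono)
      fix e assume e: "e \<in> star v"
      have "card (V e - {v}) = k - 1" using starE[OF e] card_V finite_V by simp
      then show "q ^ (k - 1) \<le> rexp p ground (\<lambda>F. of_bool (F \<inter> kills (V e - {v}) = {}))"
        using survival(1)[of "V e - {v}"] sub[OF e] by (metis Diff_subset order_trans)
    qed
    then show ?thesis unfolding deg_alive_def rexp_sum \<mu>_def by simp
  qed
  have sq: "deg_alive F v ^ 2 = (\<Sum>e\<in>star v. \<Sum>f\<in>star v. of_bool (F \<inter> kills ((V e \<union> V f) - {v}) = {}))" for F
    unfolding deg_alive_def power2_eq_square sum_product Un_Diff kills_Un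
    by (intro sum.cong refl) auto
  have A_le: "A e f \<le> (q ^ (2 * (k - 1)) + 4 * real k ^ 2 * c * p) + of_bool (V e \<inter> V f \<noteq> {v})"
    if e: "e \<in> star v" and f: "f \<in> star v" for e f
  proof (cases "V e \<inter> V f = {v}")
    case True
    let ?W = "(V e \<union> V f) - {v}"
    have "card ?W = card (V e - {v}) + card (V f - {v})"
      unfolding Un_Diff using True starE[OF e] starE[OF f] finite_V
      by (intro card_Un_disjoint) auto
    then have cW: "card ?W = 2 * (k - 1)"
      using starE[OF e] starE[OF f] finite_V card_V by simp
    have "A e f \<le> q ^ (2 * (k - 1)) + real (2 * (k - 1)) ^ 2 * c * p"
      using survival(2)[of ?W] sub[OF e] sub[OF f] unfolding cW A_def by blast
    moreover have "real (2 * (k - 1)) ^ 2 * c * p \<le> real (2 * k) ^ 2 * c * p"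
      using c p_bounds by (intro mult_right_mono power_mono) auto
    ultimately show ?thesis by (simp add: power_mult_distrib)
  next
    case False
    have "A e f \<le> rexp p ground (\<lambda>_. 1)"
      unfolding A_def using p_bounds by (intro rexp_mono) auto
    moreover have "0 \<le> q ^ (2 * (k - 1)) + 4 * real k ^ 2 * c * p"
      using q_bounds c p_bounds by (intro add_nonneg_nonneg mult_nonneg_nonneg) auto
    ultimately show ?thesis using False by (simp add: rexp_const[OF finite_ground])
  qed
  \<comment> \<open>Such an \<open>f\<close> contains a vertex \<open>u \<noteq> v\<close> of
    \<open>e\<close>. There are \<open>k - 1\<close> choices of \<open>u\<close>, each allowing at
    most \<open>c\<close> edges.\<close>
  have few: "(\<Sum>f\<in>star v. of_bool (V e \<inter> V f \<noteq> {v})) \<le> k * c" if e: "e \<in> star v" for e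
  proof -
    have "(\<Sum>f\<in>star v. of_bool (V e \<inter> V f \<noteq> {v}) :: real) = card {f\<in>star v. V e \<inter> V f \<noteq> {v}}"
      by (simp add: sum_of_bool_eq Int_def)
    also have "\<dots> \<le> card (\<Union>u\<in>V e - {v}. star u \<inter> star v)"
      using starE[OF e] finite_V finite_E
      by (intro of_nat_mono card_mono finite_UN_I finite_Int) (auto simp: star_def)
    also have "\<dots> \<le> (\<Sum>u\<in>V e - {v}. card (star u \<inter> star v))"
      using starE[OF e] finite_V by (intro of_nat_mono card_UN_le) auto
    also have "\<dots> = (\<Sum>u\<in>V e - {v}. real (card (star u \<inter> star v)))" by simp
    also have "\<dots> \<le> (\<Sum>u\<in>V e - {v}. c)"
      by (intro sum_mono card_star_Int) auto
    also have "\<dots> = (real k - 1) * c"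
      using starE[OF e] finite_V card_V k by (simp add: of_nat_diff)
    also have "\<dots> \<le> k * c" using c by (intro mult_right_mono) auto
    finally show ?thesis .
  qed
  have "rexp p ground (\<lambda>F. deg_alive F v ^ 2) = (\<Sum>e\<in>star v. \<Sum>f\<in>star v. A e f)"
    unfolding sq A_def rexp_sum ..
  also have "\<dots> \<le> (\<Sum>e\<in>star v. \<Sum>f\<in>star v.
      (q ^ (2 * (k - 1)) + 4 * real k ^ 2 * c * p) + of_bool (V e \<inter> V f \<noteq> {v}))"
    by (intro sum_mono A_le)
  also have "\<dots> = (\<Sum>e\<in>star v. d * (q ^ (2 * (k - 1)) + 4 * real k ^ 2 * c * p) +
      (\<Sum>f\<in>star v. of_bool (V e \<inter> V f \<noteq> {v})))"
    by (simp add: sum.distrib d_def)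
  also have "\<dots> \<le> (\<Sum>e\<in>star v. d * (q ^ (2 * (k - 1)) + 4 * real k ^ 2 * c * p) + k * c)"
    by (intro sum_mono add_left_mono few)
  also have "\<dots> = d ^ 2 * (q ^ (2 * (k - 1)) + 4 * real k ^ 2 * c * p) + d * (k * c)"
    by (simp add: d_def power2_eq_square algebra_simps)
  finally have second: "rexp p ground (\<lambda>F. deg_alive F v ^ 2) \<le>
      d ^ 2 * (q ^ (2 * (k - 1)) + 4 * real k ^ 2 * c * p) + d * (k * c)" .
  have mu2: "\<mu> ^ 2 = d ^ 2 * q ^ (2 * (k - 1))"
    by (simp add: \<mu>_def d_def power_mult_distrib power_mult mult.commute flip: power_even_eq)
  have mu0: "0 \<le> \<mu>" using q_bounds by (simp add: \<mu>_def)
  have "rexp p ground (\<lambda>F. (deg_alive F v - \<mu>) ^ 2) =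
      rexp p ground (\<lambda>F. (deg_alive F v ^ 2 - 2 * \<mu> * deg_alive F v) + \<mu> ^ 2)"
    by (intro arg_cong[where f = "rexp p ground"] ext) (simp add: power2_diff)
  also have "\<dots> = rexp p ground (\<lambda>F. deg_alive F v ^ 2) - 2 * \<mu> * rexp p ground (\<lambda>F. deg_alive F v) + \<mu> ^ 2"
    by (simp add: rexp_add rexp_diff rexp_cmult rexp_const[OF finite_ground])
  \<comment> \<open>The mean has a negative coefficient here, so the lower bound
    \<open>first\<close> suffices.\<close>
  also have "\<dots> \<le> rexp p ground (\<lambda>F. deg_alive F v ^ 2) - \<mu> ^ 2"
    using mult_left_mono[OF first mu0] by (simp add: power2_eq_square)
  also have "\<dots> \<le> d ^ 2 * (4 * real k ^ 2 * c * p) + d * (k * c)"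
    using second unfolding mu2 by (simp add: distrib_left)
  also have "\<dots> \<le> real D ^ 2 * (4 * real k ^ 2 * c * p) + D * (k * c)"
    using d c p_bounds by (intro add_mono mult_right_mono power_mono) auto
  finally show ?thesis .
qed

text \<open>Chebyshev's inequality, applied around \<open>\<mu>\<close>, which is at most
  \<open>D * q ^ (k - 1)\<close>.\<close>

lemma bad_prob:
  fixes \<gamma> :: real
  assumes v: "v \<in> verts" and \<gamma>: "\<gamma> > 0"
  shows "rexp p ground (\<lambda>F. of_bool (bad \<gamma> F v)) \<le>
    (real D ^ 2 * (4 * real k ^ 2 * c * p) + D * (k * c)) / (\<gamma> * D) ^ 2"
proof -
  define \<mu> where "\<mu> = card (star v) * q ^ (k - 1)"
  have mu: "\<mu> \<le> D * q ^ (k - 1)"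
    unfolding \<mu>_def using card_star[of v] q_bounds by (intro mult_right_mono) auto
  have pos: "0 < \<gamma> * D" using \<gamma> D by simp
  have "rexp p ground (\<lambda>F. of_bool (bad \<gamma> F v)) \<le>
      rexp p ground (\<lambda>F. (1 / (\<gamma> * D) ^ 2) * (deg_alive F v - \<mu>) ^ 2)"
  proof (intro rexp_mono p_bounds)
    fix F
    show "of_bool (bad \<gamma> F v) \<le> (1 / (\<gamma> * D) ^ 2) * (deg_alive F v - \<mu>) ^ 2"
    proof (cases "bad \<gamma> F v")
      case True
      then have "\<gamma> * D \<le> deg_alive F v - \<mu>"
        using mu by (simp add: bad_def algebra_simps)
      then have "(\<gamma> * D) ^ 2 \<le> (deg_alive F v - \<mu>) ^ 2"
        using pos by (intro power_mono) auto
      then show ?thesis using pos True \<gamma> D by (simp add: le_divide_eq)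
    qed auto
  qed
  also have "\<dots> = (1 / (\<gamma> * D) ^ 2) * rexp p ground (\<lambda>F. (deg_alive F v - \<mu>) ^ 2)"
    by (rule rexp_cmult)
  also have "\<dots> \<le> (1 / (\<gamma> * D) ^ 2) * (real D ^ 2 * (4 * real k ^ 2 * c * p) + D * (k * c))"
    unfolding \<mu>_def using pos by (intro mult_left_mono deg_alive_second_moment v) auto
  finally show ?thesis by simp
qed

text \<open>The isolated edges and the surviving edges have to be plentiful for the same
  \<open>F\<close>, so the first moment method is applied to a single weighted sum. The weight
  \<open>a\<close> will be the matching size per surviving edge that the induction
  guarantees.\<close>

lemma exists_good_nibble:
  fixes \<gamma> a \<beta> :: real
  assumes \<gamma>: "\<gamma> > 0" and a: "a \<ge> 0"
    and \<beta>: "\<beta> = (real D ^ 2 * (4 * real k ^ 2 * c * p) + D * (k * c)) / (\<gamma> * D) ^ 2"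
  shows "\<exists>F. card E * (p * q ^ k + a * (q ^ k - k * \<beta>)) \<le> card (chosen F) + a * card (rest \<gamma> F)"
proof -
  have V_sub: "V e \<subseteq> verts" if "e \<in> E" for e using that by (auto simp: verts_def)
  have ch: "p * q ^ k \<le> rexp p ground (\<lambda>F. of_bool (F \<inter> kills (V e) = {Inl e}))" if e: "e \<in> E" for e
  proof -
    have "V e \<noteq> {}" using card_V[OF e] k by auto
    then have "Inl e \<in> kills (V e)" using e by (auto simp: kills_def kill_def star_def)
    then have eq: "rexp p ground (\<lambda>F. of_bool (F \<inter> kills (V e) = {Inl e})) = p * (1 - p) ^ (card (kills (V e)) - 1)"
      using kills_subset[OF V_sub[OF e]] finite_ground by (intro rexp_single) auto
    have "card (kills (V e)) \<le> (\<Sum>u\<in>V e. card (kill u))"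
      unfolding kills_def by (rule card_UN_le[OF finite_V[OF e]])
    then have "card (kills (V e)) - 1 \<le> D * k" by (simp add: card_kill card_V[OF e] mult.commute)
    then have "q ^ k \<le> (1 - p) ^ (card (kills (V e)) - 1)"
      unfolding q_def power_mult[symmetric] using p_bounds by (intro power_decreasing) auto
    then show ?thesis unfolding eq using p_bounds by (intro mult_left_mono)
  qed
  have re: "q ^ k - k * \<beta> \<le> rexp p ground (\<lambda>F. of_bool (e \<in> rest \<gamma> F))" if e: "e \<in> E" for e
  proof -
    have "q ^ k - k * \<beta> \<le> rexp p ground (\<lambda>F. of_bool (F \<inter> kills (V e) = {})) -
        (\<Sum>v\<in>V e. rexp p ground (\<lambda>F. of_bool (bad \<gamma> F v)))"
    proof (rule diff_mono)
      show "q ^ k \<le> rexp p ground (\<lambda>F. of_bool (F \<inter> kills (V e) = {}))"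
        using survival(1)[OF V_sub[OF e]] card_V[OF e] by simp
      have "(\<Sum>v\<in>V e. rexp p ground (\<lambda>F. of_bool (bad \<gamma> F v))) \<le> (\<Sum>v\<in>V e. \<beta>)"
        unfolding \<beta> using V_sub[OF e] by (intro sum_mono bad_prob \<gamma>) auto
      then show "(\<Sum>v\<in>V e. rexp p ground (\<lambda>F. of_bool (bad \<gamma> F v))) \<le> k * \<beta>"
        using card_V[OF e] by simp
    qed
    also have "\<dots> = rexp p ground (\<lambda>F. of_bool (F \<inter> kills (V e) = {}) - (\<Sum>v\<in>V e. of_bool (bad \<gamma> F v)))"
      by (simp add: rexp_diff rexp_sum)
    also have "\<dots> \<le> rexp p ground (\<lambda>F. of_bool (e \<in> rest \<gamma> F))"
    proof (intro rexp_mono p_bounds)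
      fix F
      show "of_bool (F \<inter> kills (V e) = {}) - (\<Sum>v\<in>V e. of_bool (bad \<gamma> F v)) \<le> (of_bool (e \<in> rest \<gamma> F) :: real)"
      proof (cases "\<exists>v\<in>V e. bad \<gamma> F v")
        case True
        then obtain v where v: "v \<in> V e" "bad \<gamma> F v" by blast
        have "of_bool (bad \<gamma> F v) \<le> (\<Sum>v\<in>V e. of_bool (bad \<gamma> F v) :: real)"
          using v finite_V[OF e] by (intro member_le_sum) auto
        then have "1 \<le> (\<Sum>v\<in>V e. of_bool (bad \<gamma> F v) :: real)" using v by simp
        then show ?thesis by (simp add: of_bool_def)
      next
        case False
        then have "(\<Sum>v\<in>V e. of_bool (bad \<gamma> F v) :: real) = 0" by simp
        then show ?thesis using False e by (simp add: rest_def)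
      qed
    qed
    finally show ?thesis .
  qed
  have card_sum: "real (card {e\<in>E. P e}) = (\<Sum>e\<in>E. of_bool (P e))" for P
    using finite_E by (simp add: sum_of_bool_eq Int_def)
  have "card E * (p * q ^ k + a * (q ^ k - k * \<beta>)) = (\<Sum>e\<in>E. p * q ^ k + a * (q ^ k - k * \<beta>))"
    by simp
  also have "\<dots> \<le> (\<Sum>e\<in>E. rexp p ground (\<lambda>F. of_bool (F \<inter> kills (V e) = {Inl e})) +
      a * rexp p ground (\<lambda>F. of_bool (e \<in> rest \<gamma> F)))"
    by (intro sum_mono add_mono mult_left_mono ch re a)
  also have "\<dots> = rexp p ground (\<lambda>F. (\<Sum>e\<in>E. of_bool (F \<inter> kills (V e) = {Inl e})) +
      a * (\<Sum>e\<in>E. of_bool (e \<in> rest \<gamma> F)))"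
    by (simp add: rexp_add rexp_cmult rexp_sum sum.distrib sum_distrib_left)
  finally obtain F where F: "card E * (p * q ^ k + a * (q ^ k - k * \<beta>)) \<le>
      (\<Sum>e\<in>E. of_bool (F \<inter> kills (V e) = {Inl e})) + a * (\<Sum>e\<in>E. of_bool (e \<in> rest \<gamma> F))"
    using rexp_exists_ge[OF finite_ground p_bounds] by blast
  have "rest \<gamma> F = {e\<in>E. e \<in> rest \<gamma> F}" by (auto simp: rest_def)
  then have "real (card (rest \<gamma> F)) = (\<Sum>e\<in>E. of_bool (e \<in> rest \<gamma> F))"
    using card_sum[of "\<lambda>e. e \<in> rest \<gamma> F"] by simp
  then show ?thesis using F card_sum unfolding chosen_def by metis
qed

text \<open>A common vertex would put \<open>Inl e\<close>, an element of \<open>F\<close>, among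
  the killers of \<open>f\<close>.\<close>

lemma chosen_rest:
  assumes "e \<in> chosen F" "f \<in> chosen F \<union> rest \<gamma> F" "e \<noteq> f"
  shows "V e \<inter> V f = {}"
proof (rule ccontr)
  assume "V e \<inter> V f \<noteq> {}"
  then obtain u where u: "u \<in> V e" "u \<in> V f" by blast
  have e: "e \<in> E" "F \<inter> kills (V e) = {Inl e}" using assms by (auto simp: chosen_def)
  have "Inl e \<in> kills (V f)" using u e(1) by (auto simp: kills_def kill_def star_def)
  moreover have "Inl e \<in> F" using e by auto
  ultimately show False using assms by (auto simp: chosen_def rest_def)
qed

text \<open>Any edge of \<open>rest\<close> at \<open>v\<close> certifies that \<open>v\<close> is
  not bad; without such an edge the degree is 0.\<close>

lemma card_star_rest:
  assumes "\<gamma> > 0"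
  shows "real (card {e\<in>rest \<gamma> F. v \<in> V e}) \<le> D * (q ^ (k - 1) + \<gamma>)"
proof (cases "{e\<in>rest \<gamma> F. v \<in> V e} = {}")
  case False
  then have "\<not> bad \<gamma> F v" by (auto simp: rest_def)
  then have "deg_alive F v \<le> D * (q ^ (k - 1) + \<gamma>)" by (simp add: bad_def)
  moreover have "real (card {e\<in>rest \<gamma> F. v \<in> V e}) \<le> deg_alive F v"
  proof -
    have "{e\<in>rest \<gamma> F. v \<in> V e} \<subseteq> {e\<in>star v. F \<inter> kills (V e - {v}) = {}}"
      by (auto simp: rest_def star_def kills_def)
    then have "card {e\<in>rest \<gamma> F. v \<in> V e} \<le> card {e\<in>star v. F \<inter> kills (V e - {v}) = {}}"
      by (intro card_mono) auto
    also have "real \<dots> = deg_alive F v"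
      unfolding deg_alive_def by (simp add: sum_of_bool_eq Int_def)
    finally show ?thesis by simp
  qed
  ultimately show ?thesis by linarith
next
  case True
  then have "card {e\<in>rest \<gamma> F. v \<in> V e} = 0" by (metis card.empty)
  then show ?thesis using assms q_bounds by simp
qed

end

section \<open>Iterating the nibble\<close>

text \<open>With \<open>\<theta> = \<epsilon> / (2 * k)\<close>, the isolated edges contribute at
  least \<open>\<theta> * (1 - \<epsilon> / 2)\<close> and the matching in \<open>rest\<close> about
  \<open>\<rho> * (1 - \<theta>)\<close>. As \<open>\<rho> \<le> 1 - \<epsilon>\<close>, the gain is
  at least \<open>\<epsilon>\<^sup>2 / (4 * k)\<close>, and half of it pays for the errors.\<close>

lemma nibble_step:
  fixes k :: nat and \<rho> \<epsilon> \<delta>\<^sub>0 :: real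
  assumes k: "k \<ge> 1" and \<rho>: "0 \<le> \<rho>" "\<rho> \<le> 1 - \<epsilon>" and \<epsilon>: "0 < \<epsilon>" "\<epsilon> \<le> 1" and \<delta>0: "\<delta>\<^sub>0 > 0"
    and IH: "\<And>(E :: 'e set) (V :: 'e \<Rightarrow> 'v set) D. bounded_hypergraph k D (\<delta>\<^sub>0 * D) E V \<Longrightarrow> 1 \<le> \<delta>\<^sub>0 * D \<Longrightarrow>
        \<exists>M\<subseteq>E. hmatching V M \<and> \<rho> * card E \<le> card M * D"
  shows "\<exists>\<delta>>0::real. \<forall>(E :: 'e set) (V :: 'e \<Rightarrow> 'v set) D. bounded_hypergraph k D (\<delta> * D) E V \<longrightarrow> 1 \<le> \<delta> * D \<longrightarrow>
        (\<exists>M\<subseteq>E. hmatching V M \<and> (\<rho> + \<epsilon>\<^sup>2 / (8 * k)) * card E \<le> card M * D)"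
proof -
  define \<theta> \<gamma> where "\<theta> = \<epsilon> / (2 * k)" and "\<gamma> = \<epsilon>\<^sup>2 / (64 * k)"
  \<comment> \<open>With \<open>1 \<le> \<delta> * D\<close>, the first bound lets rounding
    \<open>D'\<close> up cost at most \<open>\<gamma> * D\<close>. The second turns the codegree
    bound \<open>\<delta> * D\<close> into \<open>\<delta>\<^sub>0 * D'\<close>, using
    \<open>\<gamma> * D \<le> D'\<close>. The third makes the probability bound
    \<open>\<beta>\<close> for bad vertices small.\<close>
  define \<delta> where "\<delta> = Min {\<gamma>, \<delta>\<^sub>0 * \<gamma>, \<gamma>\<^sup>2 * \<epsilon>\<^sup>2 / (160 * real k ^ 4)}"
  have kr: "real k \<ge> 1" "real k > 0" using k by auto
  have \<gamma>: "\<gamma> > 0" using \<epsilon> kr by (simp add: \<gamma>_def)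
  have \<theta>: "0 < \<theta>" "\<theta> < 1" and \<theta>half: "\<theta> \<le> 1/2" using \<epsilon> kr by (auto simp: \<theta>_def field_simps)
  have \<delta>: "\<delta> > 0" using \<gamma> \<delta>0 \<epsilon> kr by (simp add: \<delta>_def)
  have \<delta>_le: "\<delta> \<le> \<gamma>" "\<delta> \<le> \<delta>\<^sub>0 * \<gamma>" "\<delta> \<le> \<gamma>\<^sup>2 * \<epsilon>\<^sup>2 / (160 * real k ^ 4)" by (auto simp: \<delta>_def)
  show ?thesis
  proof (intro exI[of _ \<delta>] conjI \<delta> allI impI)
    fix E :: "'e set" and V :: "'e \<Rightarrow> 'v set" and D :: nat
    assume hg: "bounded_hypergraph k D (\<delta> * D) E V" and D1: "1 \<le> \<delta> * D"
    have D: "D \<ge> 1" "real D > 0" using D1 by (cases "D = 0"; simp)+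
    interpret nibble k D "\<delta> * D" E V \<theta>
      using hg k D \<delta> \<theta> by unfold_locales auto
    define \<beta> where "\<beta> = (real D ^ 2 * (4 * real k ^ 2 * (\<delta> * D) * p) + D * (k * (\<delta> * D))) / (\<gamma> * D) ^ 2"
    have "\<beta> = \<delta> * (4 * real k ^ 2 * \<theta> + k) / \<gamma>\<^sup>2"
      using D \<gamma> by (simp add: \<beta>_def p_def field_simps power2_eq_square)
    also have "\<dots> \<le> \<delta> * (5 * real k ^ 2) / \<gamma>\<^sup>2"
    proof -
      have "4 * real k ^ 2 * \<theta> \<le> 4 * real k ^ 2 * 1" using \<theta> by (intro mult_left_mono) auto
      moreover have "real k \<le> real k ^ 2" using kr by (simp add: power2_eq_square)
      ultimately have "4 * real k ^ 2 * \<theta> + k \<le> 5 * real k ^ 2" by linarith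
      then show ?thesis using \<delta> by (intro divide_right_mono mult_left_mono) auto
    qed
    also have "\<dots> \<le> (\<gamma>\<^sup>2 * \<epsilon>\<^sup>2 / (160 * real k ^ 4)) * (5 * real k ^ 2) / \<gamma>\<^sup>2"
      using \<delta>_le by (intro divide_right_mono mult_right_mono) auto
    also have "\<dots> = \<epsilon>\<^sup>2 / (32 * real k ^ 2)"
    proof -
      have k4: "real k ^ 4 = real k ^ 2 * real k ^ 2" by (simp flip: power_add)
      have *: "(x * e / (160 * (y * y))) * (5 * y) / x = e / (32 * y)" if "x \<noteq> 0" "y \<noteq> 0" for x y e :: real
        using that by (simp add: divide_simps)
      show ?thesis unfolding k4 using \<gamma> kr by (intro *) auto
    qed
    finally have \<beta>: "\<beta> \<le> \<epsilon>\<^sup>2 / (32 * real k ^ 2)" .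
    \<comment> \<open>The slack in \<open>D'\<close> loses \<open>2 * \<gamma>\<close> and bad
      vertices lose \<open>k * \<beta>\<close>. The factor 2 compensates for a division by
      \<open>q ^ (k - 1)\<close>, which is at least 1/2.\<close>
    define \<xi> where "\<xi> = 2 * (2 * \<gamma> + k * \<beta>)"
    have "k * \<beta> \<le> k * (\<epsilon>\<^sup>2 / (32 * real k ^ 2))" using \<beta> by (intro mult_left_mono) auto
    also have "\<dots> = \<epsilon>\<^sup>2 / (32 * k)" using kr by (simp add: field_simps power2_eq_square)
    finally have k\<beta>: "k * \<beta> \<le> \<epsilon>\<^sup>2 / (32 * k)" .
    have "\<xi> \<le> 2 * (2 * \<gamma> + \<epsilon>\<^sup>2 / (32 * k))" using k\<beta> by (simp add: \<xi>_def)
    also have "\<dots> = \<epsilon>\<^sup>2 / (8 * k)" using kr by (simp add: \<gamma>_def field_simps)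
    finally have \<xi>: "\<xi> \<le> \<epsilon>\<^sup>2 / (8 * k)" .
    have "0 \<le> \<beta>" using \<delta> \<gamma> p_bounds by (simp add: \<beta>_def)
    then have \<xi>0: "0 \<le> \<xi>" using \<gamma> by (simp add: \<xi>_def)
    have "1 + real k * (- \<theta>) \<le> (1 + (- \<theta>)) ^ k"
      using \<theta> by (intro Bernoulli_inequality) auto
    also have "\<dots> \<le> q ^ k" using q_bounds \<theta> by (intro power_mono) auto
    finally have qk: "1 - \<epsilon> / 2 \<le> q ^ k" using kr by (simp add: \<theta>_def)
    have qqk: "q ^ k = q * q ^ (k - 1)" using k by (metis Suc_diff_1 Suc_le_lessD One_nat_def power_Suc)
    have "q * q ^ (k - 1) \<le> 1 * q ^ (k - 1)" using q_bounds by (intro mult_right_mono) auto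
    then have qk1: "1/2 \<le> q ^ (k - 1)" using qk \<epsilon> qqk by simp

    define D' where "D' = nat \<lceil>D * (q ^ (k - 1) + \<gamma>)\<rceil>"
    have pos: "0 < D * (q ^ (k - 1) + \<gamma>)" using D \<gamma> qk1 by (intro mult_pos_pos) auto
    have D'_ge: "D * (q ^ (k - 1) + \<gamma>) \<le> D'" unfolding D'_def by linarith
    have "real D' < D * (q ^ (k - 1) + \<gamma>) + 1" unfolding D'_def using pos by linarith
    moreover have "\<delta> * D \<le> \<gamma> * D" using \<delta>_le by (intro mult_right_mono) auto
    ultimately have D'_le: "D' \<le> D * (q ^ (k - 1) + 2 * \<gamma>)"
      using D1 by (simp add: algebra_simps)
    have D'_pos: "real D' > 0" using D'_ge pos by linarith
    have "\<gamma> * D \<le> D'"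
    proof -
      have "D * \<gamma> \<le> D * (q ^ (k - 1) + \<gamma>)" using qk1 by (intro mult_left_mono) auto
      then show ?thesis using D'_ge by (simp add: mult.commute)
    qed
    then have "\<delta>\<^sub>0 * (\<gamma> * D) \<le> \<delta>\<^sub>0 * D'" using \<delta>0 by (intro mult_left_mono) auto
    moreover have "\<delta> * D \<le> \<delta>\<^sub>0 * \<gamma> * D" using \<delta>_le by (intro mult_right_mono) auto
    ultimately have \<delta>D': "\<delta> * D \<le> \<delta>\<^sub>0 * D'" by (simp add: mult.assoc)

    \<comment> \<open>The matching size per edge of \<open>rest\<close> that \<open>IH\<close>
      provides at maximal degree \<open>D'\<close>.\<close>
    define a where "a = \<rho> / D'"
    have a: "a \<ge> 0" using \<rho> by (simp add: a_def)
    obtain F where F: "card E * (p * q ^ k + a * (q ^ k - k * \<beta>)) \<le> card (chosen F) + a * card (rest \<gamma> F)"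
      using exists_good_nibble[OF \<gamma> a \<beta>_def] by blast
    have restE: "rest \<gamma> F \<subseteq> E" and chosenE: "chosen F \<subseteq> E" by (auto simp: rest_def chosen_def)
    have "bounded_hypergraph k D' (\<delta>\<^sub>0 * D') (rest \<gamma> F) V"
      unfolding bounded_hypergraph_def
    proof (intro conjI allI ballI impI)
      show "finite (rest \<gamma> F)" using restE finite_E finite_subset by blast
    next
      fix e assume "e \<in> rest \<gamma> F"
      then show "finite (V e)" "card (V e) = k" using restE finite_V card_V by auto
    next
      fix v
      have "real (card {e\<in>rest \<gamma> F. v \<in> V e}) \<le> D'"
        using card_star_rest[OF \<gamma>] D'_ge order_trans by blast
      then show "card {e\<in>rest \<gamma> F. v \<in> V e} \<le> D'" by simp
    next
      fix u v :: 'v assume uv: "u \<noteq> v"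
      have "card {e\<in>rest \<gamma> F. u \<in> V e \<and> v \<in> V e} \<le> card (star u \<inter> star v)"
        using restE finite_star by (intro card_mono finite_Int) (auto simp: star_def)
      then show "real (card {e\<in>rest \<gamma> F. u \<in> V e \<and> v \<in> V e}) \<le> \<delta>\<^sub>0 * D'"
        using card_star_Int[OF uv] \<delta>D' by linarith
    qed
    moreover have "1 \<le> \<delta>\<^sub>0 * D'" using D1 \<delta>D' by linarith
    ultimately obtain M' where M': "M' \<subseteq> rest \<gamma> F" "hmatching V M'" "\<rho> * card (rest \<gamma> F) \<le> card M' * D'"
      using IH by blast
    define M where "M = chosen F \<union> M'"
    have ME: "M \<subseteq> E" using restE chosenE M' by (auto simp: M_def)
    have mm: "hmatching V M"
      unfolding hmatching_def
    proof (intro ballI impI)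
      fix e f assume ef: "e \<in> M" "f \<in> M" "e \<noteq> f"
      consider "e \<in> chosen F" | "f \<in> chosen F" | "e \<in> M'" "f \<in> M'" using ef by (auto simp: M_def)
      then show "V e \<inter> V f = {}"
      proof cases
        case 1
        then show ?thesis using chosen_rest[of e F f \<gamma>] ef M' by (auto simp: M_def)
      next
        case 2
        then show ?thesis using chosen_rest[of f F e \<gamma>] ef M' by (auto simp: M_def)
      next
        case 3
        then show ?thesis using M' ef by (auto simp: hmatching_def)
      qed
    qed
    have "chosen F \<inter> M' = {}"
      using M' by (auto simp: chosen_def rest_def)
    moreover have "finite (chosen F)" "finite M'"
      using finite_subset[OF _ finite_E] chosenE restE M'(1) by auto
    ultimately have cM: "card M = card (chosen F) + card M'"
      unfolding M_def by (intro card_Un_disjoint)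
    have "a * card (rest \<gamma> F) \<le> card M'"
      using M' D'_pos by (simp add: a_def field_simps)
    then have "card E * (p * q ^ k + a * (q ^ k - k * \<beta>)) \<le> card M"
      using F cM by simp
    then have "card E * (p * q ^ k + a * (q ^ k - k * \<beta>)) * D \<le> card M * D"
      unfolding of_nat_mult by (intro mult_right_mono) auto
    moreover have "\<rho> + \<epsilon>\<^sup>2 / (8 * k) \<le> (p * q ^ k + a * (q ^ k - k * \<beta>)) * D"
    proof -
      have q\<xi>: "0 \<le> q - \<xi>"
      proof -
        have "\<epsilon>\<^sup>2 / (8 * k) \<le> 1 / 8"
          using \<epsilon> kr power_le_one[of \<epsilon> 2] by (simp add: field_simps)
        then show ?thesis using \<xi> q_bounds(1) \<theta>half by simp
      qed
      \<comment> \<open>In the ratio of edges to maximal degree at least the fraction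
        \<open>q - \<xi>\<close> is retained. Inserting the upper bound for \<open>D'\<close> uses
        that this fraction is nonnegative.\<close>
      have "(q - \<xi>) * D' \<le> (q - \<xi>) * (D * (q ^ (k - 1) + 2 * \<gamma>))"
        using D'_le q\<xi> by (intro mult_left_mono) auto
      also have "\<dots> = D * ((q - \<xi>) * (q ^ (k - 1) + 2 * \<gamma>))" by simp
      also have "\<dots> \<le> D * (q ^ k - k * \<beta>)"
      proof (rule mult_left_mono)
        have "q * (2 * \<gamma>) \<le> 1 * (2 * \<gamma>)" using q_bounds \<gamma> by (intro mult_right_mono) auto
        moreover have "\<xi> * (1 / 2) \<le> \<xi> * (q ^ (k - 1) + 2 * \<gamma>)"
          using \<xi>0 qk1 \<gamma> by (intro mult_left_mono) auto
        moreover have "\<xi> * (1 / 2) = 2 * \<gamma> + k * \<beta>" by (simp add: \<xi>_def)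
        moreover have "(q - \<xi>) * (q ^ (k - 1) + 2 * \<gamma>) = q ^ k + q * (2 * \<gamma>) - \<xi> * (q ^ (k - 1) + 2 * \<gamma>)"
          unfolding qqk by (simp add: algebra_simps)
        ultimately show "(q - \<xi>) * (q ^ (k - 1) + 2 * \<gamma>) \<le> q ^ k - k * \<beta>" by linarith
      qed simp
      finally have "q - \<xi> \<le> (D / D') * (q ^ k - k * \<beta>)"
        using D'_pos by (simp add: field_simps)
      then have "\<rho> * (q - \<xi>) \<le> \<rho> * ((D / D') * (q ^ k - k * \<beta>))"
        using \<rho> by (intro mult_left_mono) auto
      also have "\<dots> = a * (q ^ k - k * \<beta>) * D" by (simp add: a_def)
      finally have 1: "\<rho> * (q - \<xi>) \<le> a * (q ^ k - k * \<beta>) * D" .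
      have "\<theta> * (1 - \<epsilon> / 2) \<le> \<theta> * q ^ k" using qk \<theta> by (intro mult_left_mono) auto
      also have "\<dots> = p * q ^ k * D" using D by (simp add: p_def)
      finally have 2: "\<theta> * (1 - \<epsilon> / 2) \<le> p * q ^ k * D" .
      have "\<rho> * (1 - \<theta> - \<xi>) \<le> \<rho> * (q - \<xi>)" using q_bounds \<rho> by (intro mult_left_mono) auto
      moreover have "\<rho> * \<xi> \<le> 1 * \<xi>" using \<rho> \<epsilon> \<xi>0 by (intro mult_right_mono) auto
      moreover have "\<rho> * \<theta> \<le> (1 - \<epsilon>) * \<theta>" using \<rho> \<theta> by (intro mult_right_mono) auto
      moreover have "\<theta> * (1 - \<epsilon> / 2) - (1 - \<epsilon>) * \<theta> = \<epsilon>\<^sup>2 / (4 * k)"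
        using kr by (simp add: \<theta>_def field_simps power2_eq_square)
      moreover have "\<epsilon>\<^sup>2 / (4 * k) - \<epsilon>\<^sup>2 / (8 * k) = \<epsilon>\<^sup>2 / (8 * k)"
        using kr by (simp add: field_simps)
      moreover have "\<rho> * (1 - \<theta> - \<xi>) = \<rho> - \<rho> * \<theta> - \<rho> * \<xi>" by (simp add: algebra_simps)
      ultimately have "\<rho> + \<epsilon>\<^sup>2 / (8 * k) \<le> \<theta> * (1 - \<epsilon> / 2) + \<rho> * (q - \<xi>)"
        using \<xi> by linarith
      then show ?thesis using 1 2 by (simp add: distrib_right)
    qed
    then have "(\<rho> + \<epsilon>\<^sup>2 / (8 * k)) * card E \<le> (p * q ^ k + a * (q ^ k - k * \<beta>)) * D * card E"
      by (intro mult_right_mono) auto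
    ultimately have "(\<rho> + \<epsilon>\<^sup>2 / (8 * k)) * card E \<le> card M * D"
      by (simp add: mult_ac)
    then show "\<exists>M\<subseteq>E. hmatching V M \<and> (\<rho> + \<epsilon>\<^sup>2 / (8 * k)) * card E \<le> card M * D"
      using ME mm by blast
  qed
qed

text \<open>A form of the Frankl-Roedl and Pippenger theorem that measures the matching against
  \<open>card E / D\<close>, a quantity that passes to irregular subhypergraphs. Starting from the
  empty matching, each step gains \<open>\<eta>\<close>; the truncation at
  \<open>1 - \<epsilon>\<close> keeps \<open>nibble_step\<close> applicable.\<close>

lemma nearly_perfect_matching:
  fixes k :: nat and \<epsilon> :: real
  assumes k: "k \<ge> 1" and \<epsilon>: "0 < \<epsilon>" "\<epsilon> \<le> 1"
  shows "\<exists>\<delta>>0::real. \<forall>(E :: 'e set) (V :: 'e \<Rightarrow> 'v set) D. bounded_hypergraph k D (\<delta> * D) E V \<longrightarrow> 1 \<le> \<delta> * D \<longrightarrow>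
        (\<exists>M\<subseteq>E. hmatching V M \<and> (1 - \<epsilon>) * card E \<le> card M * D)"
proof -
  define \<eta> where "\<eta> = \<epsilon>\<^sup>2 / (8 * k)"
  have \<eta>: "\<eta> > 0" using k \<epsilon> by (simp add: \<eta>_def)
  define P where "P \<delta> \<rho> \<longleftrightarrow> (\<forall>(E :: 'e set) (V :: 'e \<Rightarrow> 'v set) D.
      bounded_hypergraph k D (\<delta> * D) E V \<longrightarrow> 1 \<le> \<delta> * D \<longrightarrow>
      (\<exists>M\<subseteq>E. hmatching V M \<and> \<rho> * card E \<le> card M * D))" for \<delta> \<rho> :: real
  have mono: "P \<delta> \<rho>" if P: "P \<delta> \<rho>'" and le: "\<rho> \<le> \<rho>'" for \<delta> \<rho> \<rho>'
    unfolding P_def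
  proof (intro allI impI)
    fix E :: "'e set" and V :: "'e \<Rightarrow> 'v set" and D :: nat
    assume "bounded_hypergraph k D (\<delta> * D) E V" "1 \<le> \<delta> * D"
    then obtain M where M: "M \<subseteq> E" "hmatching V M" "\<rho>' * card E \<le> card M * D"
      using P unfolding P_def by meson
    moreover have "\<rho> * card E \<le> \<rho>' * card E" using le by (intro mult_right_mono) auto
    ultimately show "\<exists>M\<subseteq>E. hmatching V M \<and> \<rho> * card E \<le> card M * D"
      by (intro exI[of _ M]) auto
  qed
  have *: "\<exists>\<delta>>0. P \<delta> (min (j * \<eta>) (1 - \<epsilon>))" for j :: nat
  proof (induction j)
    case 0
    have "P 1 0"
      unfolding P_def by (intro allI impI exI[of _ "{}"]) (simp add: hmatching_def)
    then show ?case using \<epsilon> by (intro exI[of _ 1]) simp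
  next
    case (Suc j)
    define \<rho> where "\<rho> = min (j * \<eta>) (1 - \<epsilon>)"
    obtain \<delta>\<^sub>0 where \<delta>0: "\<delta>\<^sub>0 > 0" "P \<delta>\<^sub>0 \<rho>"
      using Suc unfolding \<rho>_def by blast
    have \<rho>: "0 \<le> \<rho>" "\<rho> \<le> 1 - \<epsilon>" using \<epsilon> \<eta> by (auto simp: \<rho>_def)
    have IH: "\<exists>M\<subseteq>E. hmatching V M \<and> \<rho> * card E \<le> card M * D"
      if "bounded_hypergraph k D (\<delta>\<^sub>0 * D) E V" "1 \<le> \<delta>\<^sub>0 * D"
      for E :: "'e set" and V :: "'e \<Rightarrow> 'v set" and D
      using \<delta>0(2) that unfolding P_def by simp
    have "\<exists>\<delta>>0. P \<delta> (\<rho> + \<eta>)"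
      unfolding P_def \<eta>_def by (rule nibble_step[OF k \<rho> \<epsilon> \<delta>0(1) IH])
    moreover have "min (Suc j * \<eta>) (1 - \<epsilon>) \<le> \<rho> + \<eta>"
      using \<eta> by (auto simp: \<rho>_def algebra_simps)
    ultimately show ?case using mono by meson
  qed
  obtain j :: nat where "1 - \<epsilon> < j * \<eta>" using \<eta> reals_Archimedean3 by blast
  then have "min (j * \<eta>) (1 - \<epsilon>) = 1 - \<epsilon>" by simp
  then show ?thesis using *[of j] by (simp add: P_def)
qed

section \<open>The upper bound\<close>

lemma finite_qvecs: "finite (qvecs q n)"
proof -
  have "inj_on (\<lambda>x. restrict x {..<n}) (qvecs q n)"
  proof (rule inj_onI)
    fix x y assume x: "x \<in> qvecs q n" and y: "y \<in> qvecs q n" and eq: "restrict x {..<n} = restrict y {..<n}"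
    show "x = y"
    proof
      fix i
      show "x i = y i"
      proof (cases "i < n")
        case True
        then show ?thesis using fun_cong[OF eq, of i] by simp
      next
        case False
        then show ?thesis using x y by (simp add: qvecs_def)
      qed
    qed
  qed
  moreover have "(\<lambda>x. restrict x {..<n}) ` qvecs q n \<subseteq> (\<Pi>\<^sub>E i\<in>{..<n}. {..<q})"
    by (intro image_subsetI restrict_PiE_iff[THEN iffD2]) (auto simp: qvecs_def)
  moreover have "finite (\<Pi>\<^sub>E i\<in>{..<n}. {..<q})"
    by (intro finite_PiE) auto
  ultimately show ?thesis by (meson finite_imageD finite_subset)
qed

lemma finite_codes: "finite {card C | C. cw_code q n d w C}"
proof -
  have "{card C | C. cw_code q n d w C} \<subseteq> card ` Pow (qvecs q n)"
    by (auto simp: cw_code_def)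
  then show ?thesis using finite_qvecs by (meson finite_Pow_iff finite_imageI finite_subset)
qed

lemma card_le_A_q: "cw_code q n d w C \<Longrightarrow> card C \<le> A_q q n d w"
  unfolding A_q_def by (intro Max_ge finite_codes) auto

lemma A_q_attained: obtains C where "cw_code q n d w C" "card C = A_q q n d w"
proof -
  have "cw_code q n d w {}" by (simp add: cw_code_def)
  then have "A_q q n d w \<in> {card C | C. cw_code q n d w C}"
    unfolding A_q_def by (intro Max_in finite_codes) blast
  then show ?thesis using that by auto
qed

lemma finite_supp [simp]: "finite (supp n x)"
  by (simp add: supp_def)

text \<open>The words differ only inside the union of their supports, which has at most
  \<open>2 * w - card T\<close> elements, and not on \<open>S\<close>.\<close>

lemma hdist_le_of_agree:
  assumes wx: "weight n x = w" and wy: "weight n y = w"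
    and T: "T \<subseteq> supp n x" "T \<subseteq> supp n y" and S: "S \<subseteq> T" "\<And>i. i \<in> S \<Longrightarrow> x i = y i"
  shows "hdist n x y + card T + card S \<le> 2 * w"
proof -
  let ?X = "supp n x" and ?Y = "supp n y"
  have fin: "finite T" "finite S" using T S finite_subset finite_supp by metis+
  have "{i. i < n \<and> x i \<noteq> y i} \<subseteq> (?X \<union> ?Y) - S" using S by (auto simp: supp_def)
  then have "hdist n x y \<le> card ((?X \<union> ?Y) - S)"
    unfolding hdist_def by (intro card_mono) auto
  also have "\<dots> = card (?X \<union> ?Y) - card S"
    using S T fin by (intro card_Diff_subset) auto
  finally have 1: "hdist n x y \<le> card (?X \<union> ?Y) - card S" .
  have 2: "card S \<le> card (?X \<union> ?Y)" using S T by (intro card_mono) auto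
  have "card T \<le> card (?X \<inter> ?Y)" using T by (intro card_mono) auto
  moreover have "card ?X + card ?Y = card (?X \<union> ?Y) + card (?X \<inter> ?Y)"
    by (intro card_Un_Int) auto
  ultimately show ?thesis using 1 2 wx wy by (simp add: weight_def)
qed

text \<open>Double counting of the pairs of a codeword and a \<open>t\<close>-set inside its
  support.\<close>

lemma A_q_upper:
  assumes t: "1 \<le> t" "t \<le> w" and d: "d = 2 * (w - t) + 2"
  shows "A_q q n d w * (w choose t) \<le> (q - 1) ^ (t - 1) * (n choose t)"
proof -
  obtain C where C: "cw_code q n d w C" and cC: "card C = A_q q n d w" by (rule A_q_attained)
  have CQ: "C \<subseteq> qvecs q n" using C by (simp add: cw_code_def)
  have finC: "finite C" using CQ finite_qvecs finite_subset by blast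
  define TT where "TT = {T. T \<subseteq> {..<n} \<and> card T = t}"
  have finTT: "finite TT" and cTT: "card TT = n choose t"
    using n_subsets[of "{..<n}" t] by (auto simp: TT_def)
  have few: "card {x\<in>C. T \<subseteq> supp n x} \<le> (q - 1) ^ (t - 1)" if T: "T \<in> TT" for T
  proof -
    have cT: "card T = t" and finT: "finite T" using T by (auto simp: TT_def finite_subset)
    then obtain i where i: "i \<in> T" using t by fastforce
    let ?S = "T - {i}"
    have cS: "card ?S = t - 1" using cT i finT by simp
    have "card {x\<in>C. T \<subseteq> supp n x} \<le> card (\<Pi>\<^sub>E i\<in>?S. {1..<q})"
    proof (rule card_inj_on_le)
      show "inj_on (\<lambda>x. restrict x ?S) {x\<in>C. T \<subseteq> supp n x}"
      proof (rule inj_onI, rule ccontr)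
        fix x y
        assume x: "x \<in> {x\<in>C. T \<subseteq> supp n x}" and y: "y \<in> {x\<in>C. T \<subseteq> supp n x}"
          and eq: "restrict x ?S = restrict y ?S" and ne: "x \<noteq> y"
        \<comment> \<open>Agreement on \<open>?S\<close> would leave distance at most
          \<open>2 * w - t - (t - 1) = d - 1\<close>.\<close>
        have "hdist n x y + card T + card ?S \<le> 2 * w"
        proof (rule hdist_le_of_agree)
          show "weight n x = w" "weight n y = w" using x y C by (auto simp: cw_code_def)
          show "x i = y i" if "i \<in> ?S" for i using fun_cong[OF eq, of i] that by simp
        qed (use x y in auto)
        moreover have "d \<le> hdist n x y" using C x y ne by (auto simp: cw_code_def)
        ultimately show False using cS cT t d by linarith
      qed
      show "(\<lambda>x. restrict x ?S) ` {x\<in>C. T \<subseteq> supp n x} \<subseteq> (\<Pi>\<^sub>E i\<in>?S. {1..<q})"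
      proof (intro image_subsetI restrict_PiE_iff[THEN iffD2] ballI)
        fix x j assume x: "x \<in> {x\<in>C. T \<subseteq> supp n x}" and "j \<in> ?S"
        then have "j \<in> supp n x" "x \<in> qvecs q n" using CQ by auto
        then show "x j \<in> {1..<q}" by (simp add: supp_def qvecs_def)
      qed
      show "finite (\<Pi>\<^sub>E i\<in>?S. {1..<q})" using finT by (intro finite_PiE) auto
    qed
    also have "\<dots> = (q - 1) ^ (t - 1)" using finT cS by (simp add: card_PiE)
    finally show ?thesis .
  qed
  have "A_q q n d w * (w choose t) = (\<Sum>x\<in>C. card {T\<in>TT. T \<subseteq> supp n x})"
  proof -
    have "card {T\<in>TT. T \<subseteq> supp n x} = w choose t" if "x \<in> C" for x
    proof -
      have "{T\<in>TT. T \<subseteq> supp n x} = {T. T \<subseteq> supp n x \<and> card T = t}" by (auto simp: TT_def supp_def)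
      moreover have "card (supp n x) = w" using that C by (simp add: cw_code_def weight_def)
      ultimately show ?thesis using n_subsets[of "supp n x" t] by simp
    qed
    then show ?thesis by (simp add: cC)
  qed
  also have "\<dots> = (\<Sum>x\<in>C. \<Sum>T\<in>TT. if T \<subseteq> supp n x then 1 else 0)"
    using finTT by (simp add: sum.If_cases Int_def)
  also have "\<dots> = (\<Sum>T\<in>TT. \<Sum>x\<in>C. if T \<subseteq> supp n x then 1 else 0)" by (rule sum.swap)
  also have "\<dots> = (\<Sum>T\<in>TT. card {x\<in>C. T \<subseteq> supp n x})"
    using finC by (simp add: sum.If_cases Int_def)
  also have "\<dots> \<le> (\<Sum>T\<in>TT. (q - 1) ^ (t - 1))" by (intro sum_mono few)
  finally show ?thesis by (simp add: cTT mult.commute)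
qed

section \<open>The hypergraph of typed words\<close>

text \<open>The map \<open>\<sigma>\<close> sends level \<open>j\<close> injectively into level
  \<open>Suc j mod Q\<close>. Level sizes thus never decrease around the cycle, so all are
  equal.\<close>

lemma card_level_shift:
  fixes g :: "'a \<Rightarrow> nat"
  assumes Y: "finite Y" and \<sigma>: "inj_on \<sigma> Y" "\<sigma> ` Y \<subseteq> Y" and Q: "Q \<ge> 1"
    and g: "\<And>y. y \<in> Y \<Longrightarrow> g y < Q" "\<And>y. y \<in> Y \<Longrightarrow> g (\<sigma> y) = Suc (g y) mod Q"
  shows "Q * card {y\<in>Y. g y = 0} = card Y"
proof -
  define L where "L j = card {y\<in>Y. g y = j}" for j
  have step: "L j \<le> L (Suc j mod Q)" for j
    unfolding L_def
    by (rule card_inj_on_le[of \<sigma>]) (use Y \<sigma> g in \<open>auto intro: inj_on_subset\<close>)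
  have up: "L 0 \<le> L j" if "j < Q" for j
    using that
  proof (induction j)
    case (Suc j)
    then show ?case using step[of j] by simp
  qed simp
  have down: "L (Q - 1 - j) \<le> L (Q - 1)" if "j < Q" for j
    using that
  proof (induction j)
    case (Suc j)
    have "Suc (Q - 1 - Suc j) = Q - 1 - j" using Suc.prems by simp
    then show ?case using step[of "Q - 1 - Suc j"] Suc by simp
  qed simp
  have const: "L j = L 0" if j: "j < Q" for j
  proof -
    have "L j \<le> L (Q - 1)" using down[of "Q - 1 - j"] j by simp
    also have "\<dots> \<le> L 0" using step[of "Q - 1"] Q by simp
    finally show ?thesis using up[OF j] by simp
  qed
  have "card Y = (\<Sum>j<Q. L j)"
  proof -
    have "Y = (\<Union>j<Q. {y\<in>Y. g y = j})" using g by auto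
    then have "card Y = card (\<Union>j<Q. {y\<in>Y. g y = j})" by simp
    also have "\<dots> = (\<Sum>j<Q. L j)"
      unfolding L_def using Y by (intro card_UN_disjoint) auto
    finally show ?thesis .
  qed
  also have "\<dots> = (\<Sum>j<Q. L 0)" by (rule sum.cong[OF refl const]) simp
  finally show ?thesis by (simp add: L_def)
qed

text \<open>Conditions are added one at a time. \<open>\<sigma> P\<close> preserves the common zero
  set of the other conditions while rotating \<open>g P\<close>, so each new condition divides the
  count by exactly \<open>Q\<close>.\<close>

lemma card_levels_shift:
  fixes g :: "'p \<Rightarrow> 'a \<Rightarrow> nat"
  assumes X: "finite X" and Q: "Q \<ge> 1" and PP: "finite PP"
    and g: "\<And>P s. P \<in> PP \<Longrightarrow> s \<in> X \<Longrightarrow> g P s < Q"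
    and \<sigma>: "\<And>P. P \<in> PP \<Longrightarrow> inj_on (\<sigma> P) X" "\<And>P s. P \<in> PP \<Longrightarrow> s \<in> X \<Longrightarrow> \<sigma> P s \<in> X"
    and g\<sigma>: "\<And>P s. P \<in> PP \<Longrightarrow> s \<in> X \<Longrightarrow> g P (\<sigma> P s) = Suc (g P s) mod Q"
    and g\<sigma>': "\<And>P P' s. P \<in> PP \<Longrightarrow> P' \<in> PP \<Longrightarrow> P' \<noteq> P \<Longrightarrow> s \<in> X \<Longrightarrow> g P' (\<sigma> P s) = g P' s"
  shows "Q ^ card PP * card {s\<in>X. \<forall>P\<in>PP. g P s = 0} = card X"
  using PP g \<sigma> g\<sigma> g\<sigma>'
proof (induction PP rule: finite_induct)
  case (insert P PP)
  define Y where "Y = {s\<in>X. \<forall>P\<in>PP. g P s = 0}"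
  have IH: "Q ^ card PP * card Y = card X"
    unfolding Y_def by (rule insert.IH) (use insert.prems in auto)
  have "Q * card {y\<in>Y. g P y = 0} = card Y"
  proof (rule card_level_shift)
    show "finite Y" using X by (simp add: Y_def)
    show "inj_on (\<sigma> P) Y" by (rule inj_on_subset[OF insert.prems(2)]) (auto simp: Y_def)
    show "\<sigma> P ` Y \<subseteq> Y"
    proof
      fix z assume "z \<in> \<sigma> P ` Y"
      then obtain y where y: "y \<in> Y" "z = \<sigma> P y" by blast
      then have "g P' z = 0" if "P' \<in> PP" for P'
        using insert.prems(5)[of P P' y] insert.hyps that by (auto simp: Y_def)
      then show "z \<in> Y" using insert.prems(3)[of P y] y by (auto simp: Y_def)
    qed
  qed (use Q insert.prems in \<open>auto simp: Y_def\<close>)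
  moreover have "{s\<in>X. \<forall>P\<in>insert P PP. g P s = 0} = {y\<in>Y. g P y = 0}" by (auto simp: Y_def)
  ultimately show ?case
    unfolding IH[symmetric] card_insert_disjoint[OF insert.hyps] by (simp add: mult.assoc mult.left_commute)
qed simp

definition subs :: "nat \<Rightarrow> 'a set \<Rightarrow> 'a set set" where
  "subs a R = {P. P \<subseteq> R \<and> card P = a}"

lemma finite_subs: "finite R \<Longrightarrow> finite (subs a R)"
  by (simp add: subs_def)

lemma card_subs: "finite R \<Longrightarrow> card (subs a R) = card R choose a"
  unfolding subs_def by (rule n_subsets)

lemma card_supersets_le:
  assumes "finite A" "P \<subseteq> A"
  shows "card {R\<in>subs w A. P \<subseteq> R} \<le> (card A - card P) choose (w - card P)"
proof -
  have fP: "finite P" using assms finite_subset by blast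
  have "card {R\<in>subs w A. P \<subseteq> R} \<le> card (subs (w - card P) (A - P))"
  proof (rule card_inj_on_le[of "\<lambda>R. R - P"])
    show "inj_on (\<lambda>R. R - P) {R\<in>subs w A. P \<subseteq> R}"
      by (rule inj_onI) auto
    show "(\<lambda>R. R - P) ` {R\<in>subs w A. P \<subseteq> R} \<subseteq> subs (w - card P) (A - P)"
      using fP by (auto simp: subs_def card_Diff_subset)
    show "finite (subs (w - card P) (A - P))" using assms by (simp add: finite_subs)
  qed
  then show ?thesis using assms fP by (simp add: card_subs card_Diff_subset)
qed

text \<open>A place is an attribute function with a copy number; a type together with a place is a
  coordinate of the code. A point adds the symbol, stored as one less than the nonzero entry. Cells
  are the vertices of the hypergraph: \<open>Inl\<close> for patterns on \<open>t\<close>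
  coordinates, \<open>Inr\<close> for sets of \<open>t + 1\<close> coordinates.\<close>

type_synonym place = "(nat set \<Rightarrow> nat) \<times> nat"
type_synonym point = "place \<times> nat"
type_synonym word = "nat set \<times> (nat \<Rightarrow> point)"
type_synonym cell = "nat set \<times> (nat \<Rightarrow> point) + nat set \<times> (nat \<Rightarrow> place)"

text \<open>There are \<open>r\<close> types, \<open>Q\<close> nonzero symbols, and \<open>m\<close>
  copies of every combination of attributes.\<close>

locale typed_words =
  fixes r m Q t w :: nat
  assumes Q: "Q \<ge> 1" and t: "1 \<le> t" "t \<le> w" and w: "w \<le> r"
begin

definition Attr :: "(nat set \<Rightarrow> nat) set" where
  "Attr = (\<Pi>\<^sub>E P\<in>subs t {..<r}. {..<Q})"

definition Pos :: "place set" where "Pos = Attr \<times> {..<m}"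

definition Points :: "point set" where "Points = Pos \<times> {..<Q}"

definition b :: nat where "b = Q ^ (r choose t) * m * Q"

text \<open>The linear equation attached to the type set \<open>P\<close>; the attributes of its
  points at \<open>P\<close> supply the constant term. Every \<open>P\<close> reads its own
  attributes, so different checks can be changed independently.\<close>

definition chk :: "nat set \<Rightarrow> (nat \<Rightarrow> point) \<Rightarrow> nat" where
  "chk P s = (\<Sum>\<tau>\<in>P. snd (s \<tau>) + fst (fst (s \<tau>)) P) mod Q"

definition words :: "word set" where
  "words = (SIGMA R:subs w {..<r}. {s \<in> (\<Pi>\<^sub>E \<tau>\<in>R. Points). \<forall>P\<in>subs t R. chk P s = 0})"

text \<open>The \<open>Inr\<close> cells drop the symbols: two words sharing \<open>t + 1\<close>
  coordinates collide whatever their entries are.\<close>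

fun cells :: "word \<Rightarrow> cell set" where
  "cells (R, s) = (\<lambda>P. Inl (P, restrict s P)) ` subs t R \<union>
     (\<lambda>U. Inr (U, restrict (\<lambda>\<tau>. fst (s \<tau>)) U)) ` subs (Suc t) R"

definition ext :: "nat set \<Rightarrow> nat set \<Rightarrow> (nat \<Rightarrow> point) \<Rightarrow> (nat \<Rightarrow> point) set" where
  "ext R P p = (\<Pi>\<^sub>E \<tau>\<in>R. if \<tau> \<in> P then {p \<tau>} else Points)"

lemma finite_Attr: "finite Attr" and card_Attr: "card Attr = Q ^ (r choose t)"
  by (auto simp: Attr_def finite_PiE finite_subs card_PiE card_subs)

lemma finite_Pos: "finite Pos" and card_Pos: "card Pos = Q ^ (r choose t) * m"
  by (auto simp: Pos_def finite_Attr card_Attr card_cartesian_product)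

lemma finite_Points: "finite Points" and card_Points: "card Points = b"
  by (auto simp: Points_def finite_Pos card_Pos card_cartesian_product b_def)

lemma subs_typesD: "R \<in> subs a {..<r} \<Longrightarrow> R \<subseteq> {..<r} \<and> finite R \<and> card R = a"
  using finite_subset[of R "{..<r}"] by (auto simp: subs_def)

lemma card_ext:
  assumes "finite R" "P \<subseteq> R"
  shows "card (ext R P p) = b ^ (card R - card P)" and "finite (ext R P p)"
proof -
  have fP: "finite P" using assms finite_subset by blast
  have "card (ext R P p) = (\<Prod>\<tau>\<in>R. if \<tau> \<in> P then 1 else b)"
    unfolding ext_def using assms(1) by (simp add: card_PiE card_Points if_distrib cong: if_cong)
  also have "\<dots> = b ^ card (R - P)"
  proof -
    have "R \<inter> - {\<tau>. \<tau> \<in> P} = R - P" by auto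
    then show ?thesis using assms(1) by (simp add: prod.If_cases)
  qed
  finally show "card (ext R P p) = b ^ (card R - card P)"
    using assms fP by (simp add: card_Diff_subset)
  show "finite (ext R P p)"
    unfolding ext_def using finite_Points by (intro finite_PiE assms(1)) simp
qed

definition shift :: "nat set \<Rightarrow> point \<Rightarrow> point" where
  "shift P y = (((fst (fst y))(P := Suc (fst (fst y) P) mod Q), snd (fst y)), snd y)"

lemma shift_Points:
  assumes P: "P \<in> subs t {..<r}" and y: "y \<in> Points"
  shows "shift P y \<in> Points"
proof -
  have "fst (fst y) \<in> Attr" using y by (auto simp: Points_def Pos_def)
  then have "(fst (fst y))(P := Suc (fst (fst y) P) mod Q) \<in> (\<Pi>\<^sub>E P\<in>insert P (subs t {..<r}). {..<Q})"
    unfolding Attr_def using Q by (intro PiE_fun_upd) auto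
  then have "(fst (fst y))(P := Suc (fst (fst y) P) mod Q) \<in> Attr"
    using P by (simp add: Attr_def insert_absorb)
  then show ?thesis using y by (auto simp: shift_def Points_def Pos_def)
qed

lemma shift_inj:
  assumes P: "P \<in> subs t {..<r}" and y: "y \<in> Points" "z \<in> Points" and eq: "shift P y = shift P z"
  shows "y = z"
proof -
  have lt: "fst (fst y) P < Q" "fst (fst z) P < Q"
    using y P by (auto simp: Points_def Pos_def Attr_def PiE_iff)
  have *: "snd y = snd z" "snd (fst y) = snd (fst z)"
    "(fst (fst y))(P := Suc (fst (fst y) P) mod Q) = (fst (fst z))(P := Suc (fst (fst z) P) mod Q)"
    using eq by (auto simp: shift_def)
  have "fst (fst y) P' = fst (fst z) P'" for P'
  proof (cases "P' = P")
    case True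
    have "Suc (fst (fst y) P) mod Q = Suc (fst (fst z) P) mod Q"
      using fun_cong[OF *(3), of P] by simp
    then show ?thesis using lt True by (auto simp: mod_Suc split: if_splits)
  next
    case False
    then show ?thesis using fun_cong[OF *(3), of P'] by simp
  qed
  then have "fst (fst y) = fst (fst z)" by blast
  then show ?thesis using * by (simp add: prod_eq_iff)
qed

text \<open>Incrementing the attribute of a single free coordinate that belongs to the type set
  \<open>P\<close> rotates the check of \<open>P\<close> and leaves all other checks alone, so the checks that
  involve a free coordinate are jointly uniform.\<close>

lemma card_ext_checked:
  assumes R: "R \<in> subs w {..<r}" and P0: "P\<^sub>0 \<subseteq> R"
    and PP: "PP \<subseteq> subs t R" "\<And>P. P \<in> PP \<Longrightarrow> \<not> P \<subseteq> P\<^sub>0"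
  shows "Q ^ card PP * card {s \<in> ext R P\<^sub>0 p. \<forall>P\<in>PP. chk P s = 0} = b ^ (w - card P\<^sub>0)"
proof -
  have finR: "finite R" and cR: "card R = w" and Rr: "R \<subseteq> {..<r}" using subs_typesD[OF R] by auto
  define \<tau> where "\<tau> P = (SOME x. x \<in> P - P\<^sub>0)" for P
  define \<sigma> where "\<sigma> P s = s(\<tau> P := shift P (s (\<tau> P)))" for P and s :: "nat \<Rightarrow> point"
  have \<tau>: "\<tau> P \<in> P - P\<^sub>0" if "P \<in> PP" for P
  proof -
    have "\<exists>x. x \<in> P - P\<^sub>0" using PP(2)[OF that] by blast
    then show ?thesis unfolding \<tau>_def by (rule someI_ex)
  qed
  have PPr: "P \<in> subs t {..<r}" "P \<subseteq> R" "finite P" if "P \<in> PP" for P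
  proof -
    have "P \<subseteq> R" "card P = t" using that PP(1) by (auto simp: subs_def)
    then show "P \<in> subs t {..<r}" "P \<subseteq> R" "finite P"
      using Rr finite_subset[OF _ finR] by (auto simp: subs_def)
  qed
  have free: "s (\<tau> P) \<in> Points" if "P \<in> PP" "s \<in> ext R P\<^sub>0 p" for P s
  proof -
    have "\<tau> P \<in> R" "\<tau> P \<notin> P\<^sub>0" using \<tau>[OF that(1)] PPr[OF that(1)] by auto
    then show ?thesis using that(2) by (auto simp: ext_def PiE_iff split: if_splits)
  qed
  have "Q ^ card PP * card {s \<in> ext R P\<^sub>0 p. \<forall>P\<in>PP. chk P s = 0} = card (ext R P\<^sub>0 p)"
  proof (rule card_levels_shift[of _ _ _ chk \<sigma>])
    show "finite (ext R P\<^sub>0 p)" using card_ext finR P0 by blast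
    show "Q \<ge> 1" by (rule Q)
    show "finite PP" using PP finite_subs[OF finR] finite_subset by blast
    show "chk P s < Q" for P s using Q by (simp add: chk_def)
  next
    fix P assume P: "P \<in> PP"
    show "inj_on (\<sigma> P) (ext R P\<^sub>0 p)"
    proof (rule inj_onI)
      fix s s' assume s: "s \<in> ext R P\<^sub>0 p" "s' \<in> ext R P\<^sub>0 p" and eq: "\<sigma> P s = \<sigma> P s'"
      have "shift P (s (\<tau> P)) = shift P (s' (\<tau> P))"
        using fun_cong[OF eq, of "\<tau> P"] by (simp add: \<sigma>_def)
      then have "s (\<tau> P) = s' (\<tau> P)"
        using shift_inj PPr(1)[OF P] free P s by blast
      moreover have "s x = s' x" if "x \<noteq> \<tau> P" for x
        using fun_cong[OF eq, of x] that by (simp add: \<sigma>_def)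
      ultimately show "s = s'" by (metis ext)
    qed
  next
    fix P s assume P: "P \<in> PP" and s: "s \<in> ext R P\<^sub>0 p"
    have "\<sigma> P s \<in> (\<Pi>\<^sub>E x\<in>insert (\<tau> P) R. if x \<in> P\<^sub>0 then {p x} else Points)"
      unfolding \<sigma>_def using s \<tau>[OF P] shift_Points[OF PPr(1)[OF P] free[OF P s]]
      by (intro PiE_fun_upd) (auto simp: ext_def)
    then show "\<sigma> P s \<in> ext R P\<^sub>0 p"
      using \<tau>[OF P] PPr(2)[OF P] by (simp add: ext_def insert_absorb subset_iff)
    have rm: "(\<Sum>x\<in>P. h x) = h (\<tau> P) + (\<Sum>x\<in>P - {\<tau> P}. h x)" for h :: "nat \<Rightarrow> nat"
      using \<tau>[OF P] PPr(3)[OF P] by (intro sum.remove) auto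
    have "chk P (\<sigma> P s) = (snd (s (\<tau> P)) + Suc (fst (fst (s (\<tau> P))) P) mod Q +
        (\<Sum>x\<in>P - {\<tau> P}. snd (s x) + fst (fst (s x)) P)) mod Q"
      unfolding chk_def rm by (simp add: \<sigma>_def shift_def)
    also have "\<dots> = Suc (snd (s (\<tau> P)) + fst (fst (s (\<tau> P))) P +
        (\<Sum>x\<in>P - {\<tau> P}. snd (s x) + fst (fst (s x)) P)) mod Q"
    proof -
      have "(x + Suc y mod Q + z) mod Q = (x + Suc y + z) mod Q" for x y z :: nat
        by (metis mod_add_left_eq mod_add_right_eq)
      then show ?thesis by simp
    qed
    also have "\<dots> = Suc (chk P s) mod Q"
      unfolding chk_def rm by (simp add: mod_simps)
    finally show "chk P (\<sigma> P s) = Suc (chk P s) mod Q" .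
  next
    fix P P' s assume "P' \<noteq> (P :: nat set)"
    then show "chk P' (\<sigma> P s) = chk P' s"
      unfolding chk_def by (intro arg_cong[where f = "\<lambda>x. x mod Q"] sum.cong) (auto simp: \<sigma>_def shift_def)
  qed
  then show ?thesis using card_ext(1)[OF finR P0] cR by simp
qed

lemma ext_empty: "ext R {} p = (\<Pi>\<^sub>E \<tau>\<in>R. Points)"
  by (simp add: ext_def)

lemma finite_checked: "R \<in> subs w {..<r} \<Longrightarrow> finite {s \<in> ext R P p. \<forall>P\<in>PP. chk P s = 0}"
  unfolding ext_def
  by (intro finite_Collect_conjI disjI1 finite_PiE) (simp_all add: subs_typesD finite_PiE finite_Points)

lemma words_ext: "words = (SIGMA R:subs w {..<r}. {s \<in> ext R {} undefined. \<forall>P\<in>subs t R. chk P s = 0})"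
  by (simp add: words_def ext_empty)

lemma finite_words: "finite words"
  unfolding words_ext by (intro finite_SigmaI finite_subs finite_checked) auto

text \<open>With no coordinate fixed every check has a free one, as \<open>t\<close> is positive, so
  each of the \<open>w choose t\<close> checks costs exactly a factor \<open>Q\<close>.\<close>

lemma card_words: "Q ^ (w choose t) * card words = (r choose w) * b ^ w"
proof -
  have "Q ^ (w choose t) * card words = (\<Sum>R\<in>subs w {..<r}. Q ^ (w choose t) *
      card {s \<in> ext R {} undefined. \<forall>P\<in>subs t R. chk P s = 0})"
    unfolding words_ext sum_distrib_left[symmetric]
    using finite_checked by (subst card_SigmaI) (auto simp: finite_subs)
  also have "\<dots> = (\<Sum>R\<in>subs w {..<r}. b ^ w)"
  proof (rule sum.cong[OF refl])
    fix R assume R: "R \<in> subs w {..<r}"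
    have "\<not> P \<subseteq> {}" if "P \<in> subs t R" for P using that t by (auto simp: subs_def)
    then have "Q ^ card (subs t R) * card {s \<in> ext R {} undefined. \<forall>P\<in>subs t R. chk P s = 0} =
        b ^ (w - card ({} :: nat set))"
      by (intro card_ext_checked R) auto
    then show "Q ^ (w choose t) * card {s \<in> ext R {} undefined. \<forall>P\<in>subs t R. chk P s = 0} = b ^ w"
      using subs_typesD[OF R] by (simp add: card_subs)
  qed
  finally show ?thesis by (simp add: card_subs)
qed

end

section \<open>Degrees and codegrees in the hypergraph of cells\<close>

context typed_words
begin

text \<open>The number of words through a pattern on \<open>t\<close> coordinates that passes its
  own check: choose the other types, fill them in, and divide by \<open>Q\<close> for each of the
  other checks.\<close>

definition D :: nat where
  "D = ((r - t) choose (w - t)) * (b ^ (w - t) div Q ^ ((w choose t) - 1))"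

text \<open>A crude count with \<open>t + 1\<close> places fixed: their symbols are free and all
  checks are ignored. For \<open>t < w\<close> it has one factor \<open>b\<close> less than
  \<open>D\<close>, which makes it negligible for large \<open>m\<close>.\<close>

definition codegree_bound :: nat where "codegree_bound = (r choose w) * (Q ^ Suc t * b ^ (w - Suc t))"

definition uniform_size :: nat where "uniform_size = (w choose t) + (w choose Suc t)"

lemma wordsD:
  assumes "(R, s) \<in> words"
  shows "R \<in> subs w {..<r}" "R \<subseteq> {..<r}" "finite R" "card R = w" "s \<in> (\<Pi>\<^sub>E \<tau>\<in>R. Points)"
    "\<And>P. P \<in> subs t R \<Longrightarrow> chk P s = 0"
  using assms subs_typesD[of R w] by (auto simp: words_def)

lemma cells_size:
  assumes e: "e \<in> words"
  shows "finite (cells e)" "card (cells e) = uniform_size"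
proof -
  obtain R s where [simp]: "e = (R, s)" by (cases e)
  have R: "finite R" "card R = w" using wordsD e by auto
  show "finite (cells e)" using R by (simp add: finite_subs)
  have "card (cells e) = card ((\<lambda>P. Inl (P, restrict s P) :: cell) ` subs t R) +
     card ((\<lambda>U. Inr (U, restrict (\<lambda>\<tau>. fst (s \<tau>)) U) :: cell) ` subs (Suc t) R)"
    using R by (simp add: finite_subs) (intro card_Un_disjoint; auto simp: finite_subs)
  also have "\<dots> = card (subs t R) + card (subs (Suc t) R)"
    by (intro arg_cong2[where f = "(+)"] card_image inj_onI) auto
  finally show "card (cells e) = uniform_size"
    using R by (simp add: card_subs uniform_size_def)
qed

lemma card_words_fixed_positions:
  assumes U: "card U = Suc t"
    and A: "A \<subseteq> words" "\<And>R s \<tau>. (R, s) \<in> A \<Longrightarrow> \<tau> \<in> U \<Longrightarrow> \<tau> \<in> R \<and> fst (s \<tau>) = \<pi> \<tau>"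
  shows "card A \<le> codegree_bound"
proof -
  define X where "X R = (\<Pi>\<^sub>E \<tau>\<in>R. if \<tau> \<in> U then {\<pi> \<tau>} \<times> {..<Q} else Points)" for R
  define RR where "RR = {R\<in>subs w {..<r}. U \<subseteq> R}"
  have finU: "finite U" using U card.infinite by fastforce
  have RR: "finite R" "card R = w" "U \<subseteq> R" if "R \<in> RR" for R
    using that subs_typesD[of R w] by (auto simp: RR_def)
  have finRR: "finite RR" by (simp add: RR_def finite_subs)
  have finX: "finite (X R)" if "R \<in> RR" for R
    unfolding X_def using finite_Points by (intro finite_PiE RR[OF that]) auto
  have cX: "card (X R) = Q ^ Suc t * b ^ (w - Suc t)" if R: "R \<in> RR" for R
  proof -
    have "card (X R) = (\<Prod>\<tau>\<in>R. if \<tau> \<in> U then Q else b)"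
      unfolding X_def using RR[OF R]
      by (simp add: card_PiE card_Points if_distrib card_cartesian_product cong: if_cong)
    also have "\<dots> = Q ^ card U * b ^ card (R - U)"
    proof -
      have "R \<inter> {\<tau>. \<tau> \<in> U} = U" "R \<inter> - {\<tau>. \<tau> \<in> U} = R - U" using RR[OF R] by auto
      then show ?thesis using RR(1)[OF R] by (simp add: prod.If_cases)
    qed
    finally show ?thesis using RR[OF R] finU U by (simp add: card_Diff_subset)
  qed
  have "A \<subseteq> Sigma RR X"
  proof
    fix e assume e: "e \<in> A"
    obtain R s where es: "e = (R, s)" by (cases e)
    have Rs: "(R, s) \<in> words" using e es A by auto
    have "U \<subseteq> R" using A(2)[of R s] e es by auto
    then have "R \<in> RR" using wordsD(1)[OF Rs] by (simp add: RR_def)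
    moreover have "s \<in> X R"
      unfolding X_def
    proof (rule PiE_I)
      fix \<tau> assume \<tau>: "\<tau> \<in> R"
      have "s \<tau> \<in> Points" using wordsD(5)[OF Rs] \<tau> by auto
      then show "s \<tau> \<in> (if \<tau> \<in> U then {\<pi> \<tau>} \<times> {..<Q} else Points)"
        using A(2)[of R s \<tau>] e es by (auto simp: Points_def mem_Times_iff)
    next
      fix \<tau> assume "\<tau> \<notin> R"
      then show "s \<tau> = undefined" using wordsD(5)[OF Rs] by auto
    qed
    ultimately show "e \<in> Sigma RR X" using es by simp
  qed
  then have "card A \<le> card (Sigma RR X)"
    using finRR finX by (intro card_mono finite_SigmaI) auto
  also have "\<dots> = card RR * (Q ^ Suc t * b ^ (w - Suc t))"
    using finRR finX cX by (simp add: card_SigmaI)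
  also have "\<dots> \<le> codegree_bound"
    unfolding codegree_bound_def
  proof (rule mult_right_mono)
    have "card RR \<le> card (subs w {..<r})" unfolding RR_def by (intro card_mono finite_subs) auto
    then show "card RR \<le> r choose w" by (simp add: card_subs)
  qed simp
  finally show ?thesis .
qed

text \<open>These two functions treat both kinds of cells uniformly, as partial assignments of
  places to types.\<close>

fun types_of :: "cell \<Rightarrow> nat set" where
  "types_of (Inl x) = fst x" | "types_of (Inr x) = fst x"

fun cell_place :: "cell \<Rightarrow> nat \<Rightarrow> place" where
  "cell_place (Inl x) \<tau> = fst (snd x \<tau>)" | "cell_place (Inr x) \<tau> = snd x \<tau>"

lemma cell_place_cells:
  "v \<in> cells (R, s) \<Longrightarrow> \<tau> \<in> types_of v \<Longrightarrow> \<tau> \<in> R \<and> fst (s \<tau>) = cell_place v \<tau>"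
  by (auto simp: subs_def)

text \<open>Two distinct cells of one word fix at least \<open>t + 1\<close> places. Either one of
  them is an \<open>Inr\<close> cell, or both are patterns of the same word and hence lie on
  different \<open>t\<close>-sets.\<close>

lemma codegree:
  assumes uv: "u \<noteq> v"
  shows "card {e\<in>words. u \<in> cells e \<and> v \<in> cells e} \<le> codegree_bound"
proof (cases "{e\<in>words. u \<in> cells e \<and> v \<in> cells e} = {}")
  case False
  then obtain R s where Rs: "(R, s) \<in> words" and u: "u \<in> cells (R, s)" and v: "v \<in> cells (R, s)"
    by auto
  have finR: "finite R" using wordsD[OF Rs] by simp
  have fin: "finite (types_of u \<union> types_of v)"
    using cell_place_cells[OF u] cell_place_cells[OF v] finR by (meson Un_iff finite_subset subsetI)
  have "Suc t \<le> card (types_of u \<union> types_of v)"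
  proof (cases "\<exists>x. x \<in> {u, v} \<and> card (types_of x) = Suc t")
    case True
    then obtain x where x: "x \<in> {u, v}" "card (types_of x) = Suc t" by blast
    have "card (types_of x) \<le> card (types_of u \<union> types_of v)" using x fin by (intro card_mono) auto
    then show ?thesis using x by simp
  next
    case False
    have Inl: "\<exists>P\<in>subs t R. x = Inl (P, restrict s P)" if "x \<in> {u, v}" for x
    proof -
      have "x \<in> cells (R, s)" "card (types_of x) \<noteq> Suc t" using that u v False by auto
      then show ?thesis by (auto simp: subs_def)
    qed
    obtain P P' where P: "P \<in> subs t R" "u = Inl (P, restrict s P)" "P' \<in> subs t R" "v = Inl (P', restrict s P')"
      using Inl[of u] Inl[of v] by auto
    then have ne: "P \<noteq> P'" using uv by auto
    have "P \<subset> P \<union> P'"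
    proof (rule ccontr)
      assume "\<not> P \<subset> P \<union> P'"
      then have "P' \<subseteq> P" by auto
      moreover have "card P' = card P" "finite P" using P finR by (auto simp: subs_def finite_subset)
      ultimately show False using ne card_subset_eq by metis
    qed
    then have "card P < card (P \<union> P')" using P fin by (intro psubset_card_mono) auto
    then show ?thesis using P by (simp add: subs_def)
  qed
  then obtain U where U: "U \<subseteq> types_of u \<union> types_of v" "card U = Suc t"
    using obtain_subset_with_card_n by metis
  show ?thesis
  proof (rule card_words_fixed_positions[OF U(2), of _ "\<lambda>\<tau>. fst (s \<tau>)"])
    fix R' s' \<tau> assume e: "(R', s') \<in> {e\<in>words. u \<in> cells e \<and> v \<in> cells e}" and \<tau>: "\<tau> \<in> U"
    have u': "u \<in> cells (R', s')" and v': "v \<in> cells (R', s')" using e by auto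
    consider "\<tau> \<in> types_of u" | "\<tau> \<in> types_of v" using U \<tau> by blast
    then show "\<tau> \<in> R' \<and> fst (s' \<tau>) = fst (s \<tau>)"
    proof cases
      case 1
      then show ?thesis using cell_place_cells[OF u] cell_place_cells[OF u'] by simp
    next
      case 2
      then show ?thesis using cell_place_cells[OF v] cell_place_cells[OF v'] by simp
    qed
  qed auto
next
  case True
  then show ?thesis by (metis card.empty le0)
qed

text \<open>An \<open>Inr\<close> cell fixes \<open>t + 1\<close> places, so the codegree count
  applies. A pattern on \<open>P\<close> is extended type set by type set, with
  \<open>card_ext_checked\<close> counting the fillings.\<close>

lemma degree:
  assumes codegree_bound: "codegree_bound \<le> D"
  shows "card {e\<in>words. v \<in> cells e} \<le> D"
proof (cases v)
  case (Inr x)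
  show ?thesis
  proof (cases "{e\<in>words. v \<in> cells e} = {}")
    case False
    then obtain R s where "v \<in> cells (R, s)" by auto
    then have c: "card (types_of v) = Suc t" using Inr by (auto simp: subs_def)
    have "card {e\<in>words. v \<in> cells e} \<le> codegree_bound"
    proof (rule card_words_fixed_positions[OF c, of _ "cell_place v"])
      fix R s \<tau> assume "(R, s) \<in> {e\<in>words. v \<in> cells e}" "\<tau> \<in> types_of v"
      then show "\<tau> \<in> R \<and> fst (s \<tau>) = cell_place v \<tau>"
        by (intro cell_place_cells) blast
    qed auto
    then show ?thesis using codegree_bound by simp
  next
    case True
    then show ?thesis by (metis card.empty le0)
  qed
next
  case (Inl x)
  obtain P p where v: "v = Inl (P, p)" using Inl by (cases x) auto
  show ?thesis
  proof (cases "{e\<in>words. v \<in> cells e} = {}")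
    case False
    then obtain R\<^sub>0 s\<^sub>0 where Rs0: "(R\<^sub>0, s\<^sub>0) \<in> words" "v \<in> cells (R\<^sub>0, s\<^sub>0)" by auto
    have "P \<in> subs t R\<^sub>0" using Rs0(2) v by auto
    then have P: "card P = t" "P \<subseteq> {..<r}"
      using wordsD(2)[OF Rs0(1)] by (auto simp: subs_def)
    define RR where "RR = {R\<in>subs w {..<r}. P \<subseteq> R}"
    \<comment> \<open>The check of \<open>P\<close> is dropped: it has no free coordinate, whereas
      every other \<open>t\<close>-set has one.\<close>
    define X where "X R = {s \<in> ext R P p. \<forall>P'\<in>subs t R - {P}. chk P' s = 0}" for R
    have finX: "finite (X R)" if "R \<in> RR" for R
      using that finite_checked unfolding X_def RR_def by auto
    have finRR: "finite RR" by (simp add: RR_def finite_subs)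
    have cX: "card (X R) = b ^ (w - t) div Q ^ ((w choose t) - 1)" if "R \<in> RR" for R
    proof -
      have R: "R \<in> subs w {..<r}" "P \<subseteq> R" using that by (auto simp: RR_def)
      have finR: "finite R" "card R = w" using subs_typesD[OF R(1)] by auto
      have "\<not> P' \<subseteq> P" if "P' \<in> subs t R - {P}" for P'
        using that P card_subset_eq[OF finite_subset[OF R(2) finR(1)], of P'] by (auto simp: subs_def)
      then have "Q ^ card (subs t R - {P}) * card (X R) = b ^ (w - card P)"
        unfolding X_def by (intro card_ext_checked R) auto
      moreover have "card (subs t R - {P}) = (w choose t) - 1"
      proof -
        have "P \<in> subs t R" using R P by (simp add: subs_def)
        then show ?thesis using finR by (simp add: card_subs)
      qed
      ultimately show ?thesis using P Q nonzero_mult_div_cancel_left[of "Q ^ ((w choose t) - 1)" "card (X R)"] by simp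
    qed
    have "{e\<in>words. v \<in> cells e} \<subseteq> Sigma RR X"
    proof
      fix e assume e: "e \<in> {e\<in>words. v \<in> cells e}"
      obtain R s where es: "e = (R, s)" by (cases e)
      have Rs: "(R, s) \<in> words" and vc: "v \<in> cells (R, s)" using e es by auto
      have PR: "P \<in> subs t R" "p = restrict s P" using vc v by auto
      have "R \<in> RR" using wordsD(1)[OF Rs] PR by (auto simp: RR_def subs_def)
      moreover have "s \<in> ext R P p"
        unfolding ext_def
      proof (rule PiE_I)
        fix \<tau> assume \<tau>: "\<tau> \<in> R"
        have "s \<tau> \<in> Points" using wordsD(5)[OF Rs] \<tau> by blast
        then show "s \<tau> \<in> (if \<tau> \<in> P then {p \<tau>} else Points)" using PR by simp
      next
        fix \<tau> assume "\<tau> \<notin> R"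
        then show "s \<tau> = undefined" using wordsD(5)[OF Rs] by auto
      qed
      ultimately show "e \<in> Sigma RR X" using es wordsD(6)[OF Rs] by (auto simp: X_def)
    qed
    then have "card {e\<in>words. v \<in> cells e} \<le> card (Sigma RR X)"
      using finRR finX by (intro card_mono finite_SigmaI) auto
    also have "\<dots> = card RR * (b ^ (w - t) div Q ^ ((w choose t) - 1))"
      using finRR finX cX by (simp add: card_SigmaI)
    also have "\<dots> \<le> D"
      unfolding D_def RR_def using card_supersets_le[of "{..<r}" P w] P by (intro mult_right_mono) auto
    finally show ?thesis .
  next
    case True
    then show ?thesis by (metis card.empty le0)
  qed
qed

lemma bounded_words:
  assumes "codegree_bound \<le> D" "real codegree_bound \<le> c"
  shows "bounded_hypergraph uniform_size D c words cells"
  unfolding bounded_hypergraph_def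
  using cells_size finite_words degree[OF assms(1)] codegree assms(2) by (meson of_nat_mono order_trans)

end

section \<open>Codes from matchings\<close>

context typed_words
begin

text \<open>Equal places carry equal attributes, so the check determines the last symbol modulo
  \<open>Q\<close> from the others. Distinct patterns on the same coordinates therefore differ at
  least twice.\<close>

lemma symbols_agree:
  assumes J: "finite J" "\<tau>\<^sub>0 \<in> J" and chk: "chk J s = 0" "chk J s' = 0"
    and pos: "\<And>\<tau>. \<tau> \<in> J \<Longrightarrow> fst (s \<tau>) = fst (s' \<tau>)"
    and agree: "\<And>\<tau>. \<tau> \<in> J - {\<tau>\<^sub>0} \<Longrightarrow> snd (s \<tau>) = snd (s' \<tau>)"
    and lt: "snd (s \<tau>\<^sub>0) < Q" "snd (s' \<tau>\<^sub>0) < Q"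
  shows "snd (s \<tau>\<^sub>0) = snd (s' \<tau>\<^sub>0)"
proof -
  define c where "c = fst (fst (s \<tau>\<^sub>0)) J + (\<Sum>\<tau>\<in>J - {\<tau>\<^sub>0}. snd (s \<tau>) + fst (fst (s \<tau>)) J)"
  have "(\<Sum>\<tau>\<in>J. snd (s \<tau>) + fst (fst (s \<tau>)) J) = snd (s \<tau>\<^sub>0) + c"
    using J by (simp add: sum.remove c_def)
  moreover have "(\<Sum>\<tau>\<in>J. snd (s' \<tau>) + fst (fst (s' \<tau>)) J) = snd (s' \<tau>\<^sub>0) + c"
    using J pos agree by (simp add: sum.remove c_def)
  ultimately have "[snd (s \<tau>\<^sub>0) + c = snd (s' \<tau>\<^sub>0) + c] (mod Q)"
    using chk by (simp add: chk_def cong_def)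
  then have "[snd (s \<tau>\<^sub>0) = snd (s' \<tau>\<^sub>0)] (mod Q)"
    by (simp add: cong_add_rcancel_nat)
  then show ?thesis using lt by (simp add: cong_def)
qed

text \<open>Let \<open>J\<close> be the set of types at which two matched words use the same place.
  Disjoint \<open>Inr\<close> cells force \<open>card J \<le> t\<close>. If
  \<open>card J < t\<close>, the symmetric difference of the supports is large enough; if
  \<open>card J = t\<close>, disjoint \<open>Inl\<close> cells and \<open>symbols_agree\<close>
  supply two further differences.\<close>

lemma card_matching_le_A_q:
  assumes M: "M \<subseteq> words" "hmatching cells M" and n: "r * card Pos \<le> n"
  shows "card M \<le> A_q (Suc Q) n (2 * (w - t) + 2) w"
proof -
  have "card ({..<r} \<times> Pos) \<le> card {..<n}" using n by (simp add: card_cartesian_product)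
  \<comment> \<open>An arbitrary embedding of the coordinates into \<open>{..<n}\<close>; positions
    outside its image are 0 in every codeword.\<close>
  then obtain \<iota> where \<iota>: "inj_on \<iota> ({..<r} \<times> Pos)" "\<iota> ` ({..<r} \<times> Pos) \<subseteq> {..<n}"
    using inj_on_iff_card_le[of "{..<r} \<times> Pos" "{..<n}"] finite_Pos by blast
  define pt where "pt s \<tau> = \<iota> (\<tau>, fst (s \<tau>))" for s :: "nat \<Rightarrow> point" and \<tau>
  \<comment> \<open>At most one summand is nonzero, since distinct types occupy distinct positions.
    \<open>Suc\<close> turns a stored symbol into a nonzero entry.\<close>
  define cw where "cw e i = (\<Sum>\<tau>\<in>fst e. if i = pt (snd e) \<tau> then Suc (snd (snd e \<tau>)) else 0)" for e :: word and i
  have point: "s \<tau> \<in> Points" "fst (s \<tau>) \<in> Pos" "snd (s \<tau>) < Q" "\<tau> < r" if "(R, s) \<in> words" "\<tau> \<in> R" for R s \<tau>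
  proof -
    show "s \<tau> \<in> Points" using wordsD(5)[OF that(1)] that(2) by blast
    then show "fst (s \<tau>) \<in> Pos" "snd (s \<tau>) < Q" by (auto simp: Points_def)
    show "\<tau> < r" using wordsD(2)[OF that(1)] that(2) by auto
  qed
  have pt_lt: "pt s \<tau> < n" if "(R, s) \<in> words" "\<tau> \<in> R" for R s \<tau>
    using \<iota>(2) point[OF that] by (auto simp: pt_def)
  have pt_eq: "pt s \<tau> = pt s' \<tau>' \<longleftrightarrow> \<tau> = \<tau>' \<and> fst (s \<tau>) = fst (s' \<tau>')"
    if "(R, s) \<in> words" "\<tau> \<in> R" "(R', s') \<in> words" "\<tau>' \<in> R'" for R s \<tau> R' s' \<tau>'
    unfolding pt_def using point[OF that(1,2)] point[OF that(3,4)]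
    by (subst inj_on_eq_iff[OF \<iota>(1)]) auto
  have cw_at: "cw (R, s) (pt s \<tau>) = Suc (snd (s \<tau>))" if "(R, s) \<in> words" "\<tau> \<in> R" for R s \<tau>
  proof -
    have "cw (R, s) (pt s \<tau>) = (\<Sum>\<tau>'\<in>R. if \<tau> = \<tau>' then Suc (snd (s \<tau>')) else 0)"
      unfolding cw_def using pt_eq[OF that that(1)] by (auto intro!: sum.cong)
    then show ?thesis using that wordsD(3)[OF that(1)] by simp
  qed
  have cw_out: "cw (R, s) i = 0" if "i \<notin> pt s ` R" for R s i
    unfolding cw_def using that by (intro sum.neutral) auto
  have supp_cw: "supp n (cw (R, s)) = pt s ` R" if e: "(R, s) \<in> words" for R s
  proof
    show "supp n (cw (R, s)) \<subseteq> pt s ` R"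
    proof
      fix i assume "i \<in> supp n (cw (R, s))"
      then show "i \<in> pt s ` R" using cw_out[of i s R] by (auto simp: supp_def)
    qed
    show "pt s ` R \<subseteq> supp n (cw (R, s))" using cw_at[OF e] pt_lt[OF e] by (auto simp: supp_def)
  qed
  have inj_pt: "inj_on (pt s) R" if e: "(R, s) \<in> words" for R s
    by (rule inj_onI) (use pt_eq[OF e _ e] in auto)
  have weight_cw: "weight n (cw e) = w" if "e \<in> words" for e
    using that supp_cw inj_pt wordsD(4) by (cases e) (simp add: weight_def card_image)
  have cw_qvecs: "cw e \<in> qvecs (Suc Q) n" if "e \<in> words" for e
  proof -
    obtain R s where e: "e = (R, s)" "(R, s) \<in> words" using \<open>e \<in> words\<close> by (cases e) auto
    have "cw (R, s) i < Suc Q \<and> (i \<ge> n \<longrightarrow> cw (R, s) i = 0)" for i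
    proof (cases "i \<in> pt s ` R")
      case True
      then obtain \<tau> where \<tau>: "\<tau> \<in> R" "i = pt s \<tau>" by blast
      then show ?thesis using cw_at[OF e(2) \<tau>(1)] pt_lt[OF e(2) \<tau>(1)] point(3)[OF e(2) \<tau>(1)] by simp
    next
      case False
      then show ?thesis using cw_out by simp
    qed
    then show ?thesis by (simp add: qvecs_def e(1))
  qed
  have dist: "2 * (w - t) + 2 \<le> hdist n (cw e) (cw f)" if ef: "e \<in> M" "f \<in> M" "e \<noteq> f" for e f
  proof -
    obtain R s R' s' where e: "e = (R, s)" and f: "f = (R', s')" by (cases e, cases f) auto
    have eW: "(R, s) \<in> words" and fW: "(R', s') \<in> words" using ef M e f by auto
    have disj: "cells (R, s) \<inter> cells (R', s') = {}" using M(2) ef unfolding e f hmatching_def by blast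
    note R = wordsD[OF eW] and R' = wordsD[OF fW]
    define J where "J = {\<tau>\<in>R \<inter> R'. fst (s \<tau>) = fst (s' \<tau>)}"
    have J: "J \<subseteq> R" "J \<subseteq> R'" "finite J" using R by (auto simp: J_def)
    have Jpos: "fst (s \<tau>) = fst (s' \<tau>)" if "\<tau> \<in> J" for \<tau> using that by (simp add: J_def)
    have cJ: "card J \<le> t"
    proof (rule ccontr)
      assume "\<not> card J \<le> t"
      then obtain U where U: "U \<subseteq> J" "card U = Suc t"
        using obtain_subset_with_card_n[of "Suc t" J] by auto
      have "restrict (\<lambda>\<tau>. fst (s \<tau>)) U = restrict (\<lambda>\<tau>. fst (s' \<tau>)) U"
        using U Jpos by (intro restrict_ext) auto
      moreover have "U \<in> subs (Suc t) R" "U \<in> subs (Suc t) R'" using U J by (auto simp: subs_def)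
      ultimately have "Inr (U, restrict (\<lambda>\<tau>. fst (s \<tau>)) U) \<in> cells (R, s) \<inter> cells (R', s')" by auto
      then show False using disj by blast
    qed
    define N where "N = {\<tau>\<in>J. snd (s \<tau>) \<noteq> snd (s' \<tau>)}"
    have N: "2 \<le> card N" if cJt: "card J = t"
    proof -
      have Js: "J \<in> subs t R" "J \<in> subs t R'" using J cJt by (auto simp: subs_def)
      have "restrict s J \<noteq> restrict s' J"
      proof
        assume "restrict s J = restrict s' J"
        then have "Inl (J, restrict s J) \<in> cells (R, s) \<inter> cells (R', s')" using Js by auto
        then show False using disj by blast
      qed
      then obtain \<tau>\<^sub>0 where \<tau>0: "\<tau>\<^sub>0 \<in> J" "s \<tau>\<^sub>0 \<noteq> s' \<tau>\<^sub>0" by (auto simp: restrict_def fun_eq_iff split: if_splits)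
      then have \<tau>0N: "\<tau>\<^sub>0 \<in> N" using Jpos by (auto simp: N_def prod_eq_iff)
      have "N \<noteq> {\<tau>\<^sub>0}"
      proof
        assume "N = {\<tau>\<^sub>0}"
        then have agree: "snd (s \<tau>) = snd (s' \<tau>)" if "\<tau> \<in> J - {\<tau>\<^sub>0}" for \<tau> using that by (auto simp: N_def)
        have lt: "snd (s \<tau>\<^sub>0) < Q" "snd (s' \<tau>\<^sub>0) < Q"
          using point(3)[OF eW] point(3)[OF fW] J \<tau>0(1) by blast+
        have "snd (s \<tau>\<^sub>0) = snd (s' \<tau>\<^sub>0)"
          by (rule symbols_agree[OF J(3) \<tau>0(1) R(6)[OF Js(1)] R'(6)[OF Js(2)]]) (fact Jpos agree lt)+
        then show False using \<tau>0N by (simp add: N_def)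
      qed
      then obtain \<tau>\<^sub>1 where "\<tau>\<^sub>1 \<in> N" "\<tau>\<^sub>1 \<noteq> \<tau>\<^sub>0" using \<tau>0N by blast
      then have "card {\<tau>\<^sub>0, \<tau>\<^sub>1} \<le> card N"
        using \<tau>0N J by (intro card_mono) (auto simp: N_def)
      then show ?thesis using \<open>\<tau>\<^sub>1 \<noteq> \<tau>\<^sub>0\<close> by simp
    qed
    \<comment> \<open>Positions only in the first support, only in the second, and in both with
      different entries. A position common to both supports comes from a type in
      \<open>J\<close>.\<close>
    let ?A = "pt s ` (R - J)" and ?B = "pt s' ` (R' - J)" and ?C = "pt s ` N"
    have fin: "finite ?A" "finite ?B" "finite ?C" using R R' J by (auto simp: N_def)
    have outA: "i \<notin> pt s' ` R'" if i: "i \<in> ?A" for i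
    proof
      assume "i \<in> pt s' ` R'"
      then obtain \<sigma> \<tau> where "\<sigma> \<in> R" "\<tau> \<in> R'" "\<sigma> \<notin> J" "pt s \<sigma> = pt s' \<tau>" using i by auto
      then show False using pt_eq[OF eW _ fW, of \<sigma> \<tau>] by (auto simp: J_def)
    qed
    have outB: "i \<notin> pt s ` R" if i: "i \<in> ?B" for i
    proof
      assume "i \<in> pt s ` R"
      then obtain \<sigma> \<tau> where "\<sigma> \<in> R" "\<tau> \<in> R'" "\<tau> \<notin> J" "pt s \<sigma> = pt s' \<tau>" using i by auto
      then show False using pt_eq[OF eW _ fW, of \<sigma> \<tau>] by (auto simp: J_def)
    qed
    have "?A \<union> ?B \<union> ?C \<subseteq> {i. i < n \<and> cw e i \<noteq> cw f i}"
    proof (intro Un_least subsetI)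
      fix i assume i: "i \<in> ?A"
      then obtain \<tau> where "\<tau> \<in> R" "i = pt s \<tau>" by blast
      then show "i \<in> {i. i < n \<and> cw e i \<noteq> cw f i}"
        using cw_at[OF eW] pt_lt[OF eW] cw_out[OF outA[OF i]] by (simp add: e f)
    next
      fix i assume i: "i \<in> ?B"
      then obtain \<tau> where "\<tau> \<in> R'" "i = pt s' \<tau>" by blast
      then show "i \<in> {i. i < n \<and> cw e i \<noteq> cw f i}"
        using cw_at[OF fW] pt_lt[OF fW] cw_out[OF outB[OF i]] by (simp add: e f)
    next
      fix i assume i: "i \<in> ?C"
      then obtain \<tau> where \<tau>: "\<tau> \<in> N" "i = pt s \<tau>" by blast
      then have R\<tau>: "\<tau> \<in> R" "\<tau> \<in> R'" "i = pt s' \<tau>" using J Jpos by (auto simp: N_def pt_def)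
      have "cw e i = Suc (snd (s \<tau>))" using cw_at[OF eW R\<tau>(1)] by (simp add: e \<tau>(2))
      moreover have "cw f i = Suc (snd (s' \<tau>))" using cw_at[OF fW R\<tau>(2)] by (simp add: f R\<tau>(3))
      ultimately show "i \<in> {i. i < n \<and> cw e i \<noteq> cw f i}"
        using \<tau> pt_lt[OF eW R\<tau>(1)] by (simp add: N_def)
    qed
    then have "card (?A \<union> ?B \<union> ?C) \<le> hdist n (cw e) (cw f)"
      unfolding hdist_def by (intro card_mono) auto
    moreover have "card (?A \<union> ?B \<union> ?C) = card ?A + card ?B + card ?C"
    proof -
      have "?A \<inter> ?B = {}" using outA by blast
      moreover have "(?A \<union> ?B) \<inter> ?C = {}"
      proof -
        have "?C \<subseteq> pt s ` R" using J by (auto simp: N_def)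
        then have "?B \<inter> ?C = {}" using outB by blast
        moreover have "?A \<inter> ?C = {}"
          using inj_on_image_Int[OF inj_pt[OF eW], of "R - J" N] J by (auto simp: N_def)
        ultimately show ?thesis by blast
      qed
      ultimately show ?thesis using fin by (simp add: card_Un_disjoint)
    qed
    moreover have "card ?A = w - card J"
      using card_image[OF inj_on_subset[OF inj_pt[OF eW]], of "R - J"] J R by (simp add: card_Diff_subset)
    moreover have "card ?B = w - card J"
      using card_image[OF inj_on_subset[OF inj_pt[OF fW]], of "R' - J"] J R' by (simp add: card_Diff_subset)
    moreover have "card ?C = card N"
      using card_image[OF inj_on_subset[OF inj_pt[OF eW]], of N] J by (auto simp: N_def)
    moreover have "2 * (w - t) + 2 \<le> (w - card J) + (w - card J) + card N"
      using N cJ t by (cases "card J = t") auto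
    ultimately show ?thesis by linarith
  qed
  have "cw_code (Suc Q) n (2 * (w - t) + 2) w (cw ` M)"
    unfolding cw_code_def
  proof (intro conjI ballI impI)
    show "cw ` M \<subseteq> qvecs (Suc Q) n" using cw_qvecs M by blast
    show "weight n x = w" if "x \<in> cw ` M" for x using that weight_cw M by blast
    show "2 * (w - t) + 2 \<le> hdist n x y" if "x \<in> cw ` M" "y \<in> cw ` M" "x \<noteq> y" for x y
      using that dist by blast
  qed
  then have "card (cw ` M) \<le> A_q (Suc Q) n (2 * (w - t) + 2) w" by (rule card_le_A_q)
  moreover have "inj_on cw M"
  proof (rule inj_onI, rule ccontr)
    fix e f assume "e \<in> M" "f \<in> M" "cw e = cw f" "e \<noteq> f"
    then show False using dist[of e f] by (simp add: hdist_def)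
  qed
  ultimately show ?thesis by (simp add: card_image)
qed

end

section \<open>The lower bound and the limit\<close>

lemma binomial_ge_pow: "(real r - real t) ^ t \<le> fact t * real (r choose t)" if "t \<le> r"
proof -
  have "(real r - real t) ^ t = (\<Prod>i = 0..<t. real r - real t)" by simp
  also have "\<dots> \<le> (\<Prod>i = 0..<t. real r - real i)"
    using that by (intro prod_mono) auto
  also have "\<dots> = fact t * real (r choose t)"
    by (simp add: binomial_gbinomial gbinomial_mult_fact)
  finally show ?thesis .
qed

context typed_words
begin

text \<open>The case \<open>t = w\<close> is treated apart: there \<open>D = 1\<close>, out of reach
  of the nibble. Each word has a single cell, which is the word itself, and there are no
  \<open>Inr\<close> cells.\<close>

lemma words_matching:
  assumes "t = w"
  shows "hmatching cells words"
  unfolding hmatching_def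
proof (intro ballI impI)
  fix e f assume ef: "e \<in> words" "f \<in> words" "e \<noteq> f"
  have "cells e = {Inl e}" if e: "e \<in> words" for e
  proof -
    obtain R s where es: "e = (R, s)" by (cases e)
    note R = wordsD[OF e[unfolded es]]
    have "subs t R = {R}" using R assms card_subset_eq[of R] by (auto simp: subs_def)
    moreover have "subs (Suc t) R = {}"
    proof -
      have "card U \<noteq> Suc t" if "U \<subseteq> R" for U
        using card_mono[OF R(3) that] R(4) assms by simp
      then show ?thesis by (auto simp: subs_def)
    qed
    moreover have "restrict s R = s" using R by (simp add: PiE_restrict)
    ultimately show ?thesis using es by simp
  qed
  then show "cells e \<inter> cells f = {}" using ef by simp
qed

lemma A_q_lower_trivial:
  assumes tw: "t = w" and n: "r * card Pos \<le> n"
  shows "real (r choose t) * real (card Pos) ^ t * real Q ^ (t - 1) \<le> real (w choose t) * A_q (Suc Q) n (2 * (w - t) + 2) w"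
proof -
  have "(w choose t) = 1" using tw by simp
  then have "Q * card words = (r choose w) * b ^ w" using card_words by simp
  also have "\<dots> = (r choose t) * (card Pos * Q) ^ t"
    unfolding b_def card_Pos unfolding tw[symmetric] ..
  also have "\<dots> = Q * ((r choose t) * card Pos ^ t * Q ^ (t - 1))"
    using power_minus_mult[of t Q] t by (simp add: power_mult_distrib mult_ac)
  finally have "card words = (r choose t) * card Pos ^ t * Q ^ (t - 1)" using Q by simp
  moreover have "card words \<le> A_q (Suc Q) n (2 * (w - t) + 2) w"
    using words_matching[OF tw] n by (intro card_matching_le_A_q) auto
  ultimately have "(r choose t) * card Pos ^ t * Q ^ (t - 1) \<le> (w choose t) * A_q (Suc Q) n (2 * (w - t) + 2) w"
    using tw by simp
  then have "real ((r choose t) * card Pos ^ t * Q ^ (t - 1)) \<le> real ((w choose t) * A_q (Suc Q) n (2 * (w - t) + 2) w)"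
    by (rule of_nat_mono)
  then show ?thesis by simp
qed

text \<open>The nibble gives about \<open>card words / D\<close> codewords. By \<open>(r choose w) *
  (w choose t) = (r choose t) * ((r - t) choose (w - t))\<close>, multiplying by
  \<open>w choose t\<close> turns this ratio into \<open>(r choose t) * b ^ t / Q\<close>, where
  \<open>b = card Pos * Q\<close>.\<close>

lemma A_q_lower_nibble:
  fixes \<epsilon> \<delta> :: real
  assumes tw: "t < w" and \<delta>: "\<delta> > 0"
    and nib: "\<And>(E :: word set) (V :: word \<Rightarrow> cell set) D. bounded_hypergraph uniform_size D (\<delta> * D) E V \<Longrightarrow> 1 \<le> \<delta> * D \<Longrightarrow>
        \<exists>M\<subseteq>E. hmatching V M \<and> (1 - \<epsilon>) * card E \<le> card M * D"
    and m: "real ((r choose w) * Q ^ Suc t * Q ^ (w choose t)) \<le> min \<delta> 1 * m" "m \<ge> 1"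
    and n: "r * card Pos \<le> n"
  shows "(1 - \<epsilon>) * real (r choose t) * real (card Pos) ^ t * real Q ^ (t - 1) \<le> real (w choose t) * A_q (Suc Q) n (2 * (w - t) + 2) w"
proof -
  define C where "C = (w choose t)"
  define c' where "c' = ((r - t) choose (w - t))"
  have C: "C \<ge> 1" using t by (simp add: C_def Suc_le_eq)
  have c': "c' \<ge> 1" using t w by (simp add: c'_def Suc_le_eq)
  have "1 * m * 1 \<le> b" unfolding b_def using Q by (intro mult_mono) auto
  then have bm: "m \<le> b" by simp
  have b: "b \<ge> 1" using bm m by simp
  have "C \<le> r choose t" unfolding C_def using w by (rule binomial_right_mono)
  \<comment> \<open>The division in the definition of \<open>D\<close> is exact because
    \<open>b\<close> has the factor \<open>Q ^ (r choose t)\<close>.\<close>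
  then have "Q ^ (C - 1) dvd Q ^ (r choose t)" by (intro le_imp_power_dvd) simp
  also have "\<dots> dvd b" by (simp add: b_def)
  also have "b dvd b ^ (w - t)" using tw by simp
  finally have DC1: "D * Q ^ (C - 1) = c' * b ^ (w - t)"
    by (simp add: D_def C_def c'_def mult.assoc)
  have "Q ^ C = Q * Q ^ (C - 1)" using C by (simp add: power_eq_if)
  then have DC: "D * Q ^ C = Q * c' * b ^ (w - t)" using DC1 by (simp add: mult_ac)
  have minpos: "0 < min \<delta> 1" using \<delta> by simp
  have bw: "b ^ (w - t) = b * b ^ (w - Suc t)" using tw by (metis Suc_diff_Suc power_Suc)
  \<comment> \<open>The factor \<open>b\<close> missing from \<open>codegree_bound\<close> is
    supplied by \<open>m \<le> b\<close> and the assumed size of \<open>m\<close>. Working with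
    \<open>min \<delta> 1\<close> gives the bounds by \<open>D\<close> and by
    \<open>\<delta> * D\<close> together.\<close>
  have "real codegree_bound * real Q ^ C = real ((r choose w) * Q ^ Suc t * Q ^ (w choose t)) * b ^ (w - Suc t)"
    by (simp add: codegree_bound_def C_def)
  also have "\<dots> \<le> min \<delta> 1 * m * b ^ (w - Suc t)" using m by (intro mult_right_mono) auto
  also have "\<dots> \<le> min \<delta> 1 * b * b ^ (w - Suc t)" using bm minpos by (intro mult_right_mono mult_left_mono) auto
  also have "\<dots> = min \<delta> 1 * (1 * real (1 * b ^ (w - t)))" by (simp add: bw)
  also have "\<dots> \<le> min \<delta> 1 * (real Q * real (c' * b ^ (w - t)))"
    using Q c' minpos by (intro mult_left_mono mult_mono of_nat_mono) auto
  also have "\<dots> = min \<delta> 1 * D * real Q ^ C"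
    using arg_cong[OF DC, of real] by (simp add: mult_ac)
  finally have lim_le: "real codegree_bound \<le> min \<delta> 1 * D" using Q by simp
  have "min \<delta> 1 * real D \<le> 1 * real D" by (intro mult_right_mono) auto
  moreover have "min \<delta> 1 * real D \<le> \<delta> * real D" by (intro mult_right_mono) auto
  ultimately have lim_D: "codegree_bound \<le> D" "real codegree_bound \<le> \<delta> * D" using lim_le by linarith+
  have "1 \<le> codegree_bound" unfolding codegree_bound_def using w Q b by (simp add: Suc_le_eq)
  then have "1 \<le> \<delta> * D" using lim_D by linarith
  then obtain M where M: "M \<subseteq> words" "hmatching cells M" "(1 - \<epsilon>) * card words \<le> card M * D"
    using nib[OF bounded_words[OF lim_D]] by blast
  have mult: "(r choose w) * C = (r choose t) * c'"
    unfolding C_def c'_def using t w by (intro choose_mult) auto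
  have "(1 - \<epsilon>) * real (r choose t) * b ^ t * real (c' * b ^ (w - t)) =
      (1 - \<epsilon>) * real ((r choose t) * c') * real (b ^ t * b ^ (w - t))"
    by simp
  also have "\<dots> = (1 - \<epsilon>) * C * real ((r choose w) * b ^ w)"
    using t by (simp flip: mult power_add)
  also have "\<dots> = (1 - \<epsilon>) * C * real (Q ^ C * card words)"
    unfolding C_def card_words ..
  also have "\<dots> = C * real Q ^ C * ((1 - \<epsilon>) * card words)" by simp
  also have "\<dots> \<le> C * real Q ^ C * real (card M * D)"
    using M by (intro mult_left_mono) auto
  also have "\<dots> = C * card M * real (D * Q ^ C)" by simp
  also have "\<dots> = C * card M * Q * real (c' * b ^ (w - t))" unfolding DC by simp
  finally have "(1 - \<epsilon>) * real (r choose t) * real b ^ t \<le> C * card M * real Q"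
    using c' b by (subst (asm) mult_le_cancel_right) (auto simp: of_nat_power)
  moreover have "real b ^ t = real (card Pos) ^ t * real Q ^ (t - 1) * real Q"
    using power_minus_mult[of t "real Q"] t by (simp add: b_def card_Pos power_mult_distrib mult.assoc)
  ultimately have "(1 - \<epsilon>) * real (r choose t) * real (card Pos) ^ t * real Q ^ (t - 1) * real Q \<le> C * card M * real Q"
    by (simp add: mult.assoc)
  then have "(1 - \<epsilon>) * real (r choose t) * real (card Pos) ^ t * real Q ^ (t - 1) \<le> C * card M"
    using Q by simp
  also have "\<dots> \<le> C * real (A_q (Suc Q) n (2 * (w - t) + 2) w)"
    using card_matching_le_A_q[OF M(1,2) n] unfolding of_nat_mult by (intro mult_left_mono) auto
  finally show ?thesis by (simp add: C_def)
qed

end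

text \<open>The uniformity and hence \<open>\<delta>\<close> depend only on \<open>w\<close>,
  \<open>t\<close> and \<open>\<epsilon>\<close>, so they are fixed before \<open>m\<close> is made
  large.\<close>

lemma A_q_lower:
  fixes Q w t r :: nat and \<epsilon> :: real
  assumes Q: "Q \<ge> 1" and t: "1 \<le> t" "t \<le> w" and w: "w \<le> r" and \<epsilon>: "0 < \<epsilon>" "\<epsilon> \<le> 1"
  shows "\<exists>m\<^sub>0. \<forall>m\<ge>m\<^sub>0. \<forall>n. r * (Q ^ (r choose t) * m) \<le> n \<longrightarrow>
    (1 - \<epsilon>) * real (r choose t) * real (Q ^ (r choose t) * m) ^ t * real Q ^ (t - 1)
      \<le> real (w choose t) * A_q (Suc Q) n (2 * (w - t) + 2) w"
proof (cases "t = w")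
  case True
  show ?thesis
  proof (intro exI[of _ 0] allI impI)
    fix m n assume n: "r * (Q ^ (r choose t) * m) \<le> n"
    interpret typed_words r m Q t w using Q t w by unfold_locales
    have "(1 - \<epsilon>) * (real (r choose t) * real (card Pos) ^ t * real Q ^ (t - 1)) \<le>
        1 * (real (r choose t) * real (card Pos) ^ t * real Q ^ (t - 1))"
      using \<epsilon> by (intro mult_right_mono) auto
    then show "(1 - \<epsilon>) * real (r choose t) * real (Q ^ (r choose t) * m) ^ t * real Q ^ (t - 1)
      \<le> real (w choose t) * A_q (Suc Q) n (2 * (w - t) + 2) w"
      using A_q_lower_trivial[OF True, of n] n unfolding card_Pos by (simp add: mult.assoc)
  qed
next
  case False
  then have tw: "t < w" using t by simp
  define k where "k = (w choose t) + (w choose Suc t)"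
  have "k \<ge> 1" using t by (simp add: k_def Suc_le_eq)
  from nearly_perfect_matching[OF this \<epsilon>]
  obtain \<delta> :: real where \<delta>: "\<delta> > 0" and nib: "\<And>(E :: word set) (V :: word \<Rightarrow> cell set) D.
      bounded_hypergraph k D (\<delta> * D) E V \<Longrightarrow> 1 \<le> \<delta> * D \<Longrightarrow>
      \<exists>M\<subseteq>E. hmatching V M \<and> (1 - \<epsilon>) * card E \<le> card M * D"
    by blast
  define c where "c = real ((r choose w) * Q ^ Suc t * Q ^ (w choose t))"
  show ?thesis
  proof (intro exI[of _ "max 1 (nat \<lceil>c / min \<delta> 1\<rceil>)"] allI impI)
    fix m n assume m: "max 1 (nat \<lceil>c / min \<delta> 1\<rceil>) \<le> m" and n: "r * (Q ^ (r choose t) * m) \<le> n"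
    interpret typed_words r m Q t w using Q t w by unfold_locales
    have "c / min \<delta> 1 \<le> m" using m by linarith
    then have "c \<le> min \<delta> 1 * m" using \<delta> by (simp add: field_simps)
    then show "(1 - \<epsilon>) * real (r choose t) * real (Q ^ (r choose t) * m) ^ t * real Q ^ (t - 1)
      \<le> real (w choose t) * A_q (Suc Q) n (2 * (w - t) + 2) w"
      using A_q_lower_nibble[OF tw \<delta> nib[folded uniform_size_def], unfolded card_Pos] m n
      unfolding c_def k_def uniform_size_def by auto
  qed
qed

text \<open>For the lower bound, \<open>r\<close> is fixed first and then \<open>n\<close> grows.
  Three factors \<open>1 - \<epsilon>\<close> are lost: in the matching, in comparing
  \<open>r choose t\<close> with \<open>r ^ t / fact t\<close>, and in rounding \<open>n\<close>
  down to a multiple of \<open>g\<close>.\<close>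

theorem theorem2:
  fixes q w d t :: nat
  assumes "q \<ge> 2" and "w \<ge> 1" and "even d" and "2 \<le> d" and "d \<le> 2 * w"
    and "t = w - d div 2 + 1"
  shows "(\<lambda>n. real (A_q q n d w) /
            (real (q - 1) ^ (t - 1) * real (n choose t) / real (w choose t)))
         \<longlonglongrightarrow> 1"
proof -
  define Q where "Q = q - 1"
  have q: "q = Suc Q" and Q: "Q \<ge> 1" using assms by (auto simp: Q_def)
  have t: "1 \<le> t" "t \<le> w" and d: "d = 2 * (w - t) + 2"
    using assms by (auto elim!: evenE)
  define a where "a n = real (A_q q n d w) / (real (q - 1) ^ (t - 1) * real (n choose t) / real (w choose t))" for n
  have wt: "0 < real (w choose t)" using t by simp
  have a_le: "a n \<le> 1" for n
  proof (cases "t \<le> n")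
    case True
    then have pos: "0 < real Q ^ (t - 1) * real (n choose t)" using Q by simp
    have "real (A_q q n d w * (w choose t)) \<le> real (Q ^ (t - 1) * (n choose t))"
      using A_q_upper[OF t d, of q n] by (intro of_nat_mono) (simp add: Q_def)
    then show ?thesis using pos wt by (simp add: a_def q field_simps)
  next
    \<comment> \<open>Here the denominator is 0, and division by zero yields 0.\<close>
    case False
    then have "n choose t = 0" by (intro binomial_eq_0) simp
    then show ?thesis unfolding a_def by (simp only:) simp
  qed
  have a_ge: "\<exists>N. \<forall>n\<ge>N. 1 - 3 * \<epsilon> \<le> a n" if \<epsilon>: "0 < \<epsilon>" "\<epsilon> < 1" for \<epsilon>
  proof -
    \<comment> \<open>This makes \<open>t * (t / r) \<le> \<epsilon>\<close>, so that Bernoulli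
      bounds \<open>(1 - t / r) ^ t\<close> below by \<open>1 - \<epsilon>\<close>.\<close>
    obtain r0 :: nat where r0: "real t ^ 2 / \<epsilon> \<le> r0" using real_arch_simple by blast
    define r where "r = max r0 w"
    have r: "w \<le> r" "t \<le> r" "0 < r" using t by (auto simp: r_def)
    have "real t ^ 2 / \<epsilon> \<le> r" using r0 by (simp add: r_def)
    then have tr: "t * (t / r) \<le> \<epsilon>" using \<epsilon> r by (simp add: field_simps power2_eq_square)
    define K where "K = Q ^ (r choose t)"
    have K: "K \<ge> 1" using Q by (simp add: K_def)
    define g where "g = r * K"
    have g: "g > 0" using K r by (simp add: g_def)
    obtain m0 where m0: "\<And>m n. m0 \<le> m \<Longrightarrow> r * (K * m) \<le> n \<Longrightarrow>
        (1 - \<epsilon>) * real (r choose t) * real (K * m) ^ t * real Q ^ (t - 1) \<le> real (w choose t) * A_q q n d w"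
      using A_q_lower[OF Q t r(1) \<epsilon>(1)] \<epsilon> unfolding K_def d q by (metis less_imp_le)
    obtain N0 :: nat where N0: "real t * g / \<epsilon> \<le> N0" using real_arch_simple by blast
    show ?thesis
    \<comment> \<open>\<open>t\<close> keeps \<open>n choose t\<close> positive, \<open>N0\<close>
      gives \<open>t * (g / n) \<le> \<epsilon>\<close>, \<open>g * m0\<close> gives
      \<open>m0 \<le> n div g\<close>, and \<open>g\<close> keeps \<open>n - g\<close>
      nonnegative.\<close>
    proof (intro exI[of _ "max (max 1 t) (max N0 (g * m0 + g))"] allI impI)
      fix n assume "max (max 1 t) (max N0 (g * m0 + g)) \<le> n"
      then have n: "1 \<le> n" "t \<le> n" "N0 \<le> n" "g * m0 \<le> n" "g \<le> n" by auto
      \<comment> \<open>The largest \<open>m\<close> whose \<open>g * m\<close> coordinates fit into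
        \<open>n\<close>; fewer than \<open>g\<close> positions are left over.\<close>
      define m where "m = n div g"
      have m: "m0 \<le> m" unfolding m_def using n(4) g by (simp add: less_eq_div_iff_mult_less_eq mult.commute)
      have gm: "r * (K * m) \<le> n" by (simp add: m_def g_def flip: mult.assoc)
      have "n = g * m + n mod g" by (simp add: m_def)
      moreover have "n mod g < g" using g by simp
      ultimately have "n < g * m + g" by linarith
      then have nm: "real n - g \<le> real r * real (K * m)"
        unfolding g_def by (simp add: mult.assoc flip: of_nat_mult of_nat_add)
      have "real t * g / \<epsilon> \<le> n" using N0 n by linarith
      then have tn: "t * (g / n) \<le> \<epsilon>" using \<epsilon> n by (simp add: field_simps)
      have bern: "1 - \<epsilon> \<le> (1 - x) ^ t" if "t * x \<le> \<epsilon>" "x \<le> 1" for x :: real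
        using Bernoulli_inequality[of "- x" t] that by simp
      have "(1 - \<epsilon>) * (1 - \<epsilon>) \<le> (1 - t / r) ^ t * (1 - g / n) ^ t"
        using \<epsilon> tr tn r n by (intro mult_mono bern) auto
      also have "\<dots> = ((real r - t) ^ t * (real n - g) ^ t) / (real r ^ t * real n ^ t)"
      proof -
        have "1 - t / r = (real r - t) / r" "1 - g / n = (real n - g) / n"
          using r n by (simp_all add: diff_divide_distrib)
        then show ?thesis by (simp add: power_divide)
      qed
      also have "\<dots> \<le> (fact t * real (r choose t) * (real r * real (K * m)) ^ t) / (real r ^ t * real n ^ t)"
        using binomial_ge_pow[OF r(2)] nm n(5) r
        by (intro divide_right_mono mult_mono power_mono) auto
      also have "\<dots> = fact t * real (r choose t) * real (K * m) ^ t / real n ^ t"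
        using r by (simp add: power_mult_distrib)
      also have "\<dots> \<le> real (r choose t) * real (K * m) ^ t / real (n choose t)"
      proof -
        have "real ((n choose t) * fact t) \<le> real (n ^ t)"
          by (intro of_nat_mono binomial_fact_pow)
        then have "real (n choose t) * fact t \<le> real n ^ t" by simp
        moreover have "0 < real (n choose t)" using n by simp
        moreover have "0 < real n ^ t" using n by simp
        ultimately have "fact t / real n ^ t \<le> 1 / real (n choose t)" by (simp add: field_simps)
        then have "real (r choose t) * real (K * m) ^ t * (fact t / real n ^ t) \<le>
            real (r choose t) * real (K * m) ^ t * (1 / real (n choose t))"
          by (intro mult_left_mono) auto
        then show ?thesis by (simp add: mult_ac)
      qed
      finally have "(1 - \<epsilon>) * ((1 - \<epsilon>) * (1 - \<epsilon>)) \<le> (1 - \<epsilon>) * (real (r choose t) * real (K * m) ^ t / real (n choose t))"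
        using \<epsilon> by (intro mult_left_mono) auto
      also have "\<dots> = (1 - \<epsilon>) * real (r choose t) * real (K * m) ^ t * real Q ^ (t - 1) / (real Q ^ (t - 1) * real (n choose t))"
        using Q by simp
      also have "\<dots> \<le> real (w choose t) * A_q q n d w / (real Q ^ (t - 1) * real (n choose t))"
        by (intro divide_right_mono m0 m gm) auto
      also have "\<dots> = a n" by (simp add: a_def q mult_ac)
      finally have "(1 - \<epsilon>) * ((1 - \<epsilon>) * (1 - \<epsilon>)) \<le> a n" .
      moreover have "1 + real 3 * (- \<epsilon>) \<le> (1 + (- \<epsilon>)) ^ 3"
        using \<epsilon> by (intro Bernoulli_inequality) auto
      ultimately show "1 - 3 * \<epsilon> \<le> a n" by (simp add: power3_eq_cube mult.assoc)
    qed
  qed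
  have "a \<longlonglongrightarrow> 1"
  proof (rule LIMSEQ_I)
    fix e :: real assume e: "0 < e"
    define \<epsilon> where "\<epsilon> = min (e / 4) (1 / 2)"
    have "0 < \<epsilon>" "\<epsilon> < 1" using e by (auto simp: \<epsilon>_def)
    then obtain N where N: "\<And>n. n \<ge> N \<Longrightarrow> 1 - 3 * \<epsilon> \<le> a n" using a_ge by blast
    have "3 * \<epsilon> < e" using e by (auto simp: \<epsilon>_def min_def)
    then have "norm (a n - 1) < e" if "n \<ge> N" for n using N[OF that] a_le[of n] by simp
    then show "\<exists>no. \<forall>n\<ge>no. norm (a n - 1) < e" by blast
  qed
  then show ?thesis unfolding a_def .
qed

end
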